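(* Suppose $N$ is a nonnegatively graded Artinian level $S$-module of maximal socle degree $c$. Then there is an integer $j$ such that $$\mathcal{L}_N=\mathcal{L}_{N,j-1}\cup\mathcal{L}_{N,j}.$$
   Context: Let $\mathbb{K}$ be an algebraically closed field of characteristic zero and $S=\mathbb{K}[x_1,\dots,x_r]$ with the standard grading and $\mathfrak{m}=(x_1,\dots,x_r)$. Modules are finitely generated. The socle of a graded $S$-module $N$ is $\operatorname{Soc}(N)=(0:_N\mathfrak{m})=\{x\in N: ax=0\text{ for all }a\in\mathfrak{m}\}$; the maximal socle degree is the largest degree in which $\operatorname{Soc}(N)$ is nonzero. An Artinian graded $S$-module $N$ is level if it is generated by $N_0$ as an $S$-module and $\operatorname{Soc}(N)=N_c$ for some $c$ (so $N_i=0$ for $i>c$). Non-Lefschetz locus: a form $\ell\in S_1$ is a Lefschetz element of $N$ if $\times\ell:N_j\to N_{j+1}$ has maximal rank for all $j$. In the dual projective space $(\mathbb{P}^{r-1})^*=\mathbb{P}(S_1)$, set $\mathcal{L}_N=\{[\ell]: \ell \text{ is not a Lefschetz element of } N\}$ and, for any integer $j$, $\mathcal{L}_{N,j}=\{[\ell]:\times\ell:N_j\to N_{j+1}\text{ does not have maximal rank}\}$. These are regarded as schemes: let $A=\mathbb{K}[a_1,\dots,a_r]$ be the coordinate ring of $(\mathbb{P}^{r-1})^*$, $\ell=a_1x_1+\cdots+a_rx_r$, and let $X_j$ be the $\dim_{\mathbb{K}} N_{j+1}\times\dim_{\mathbb{K}} N_j$ matrix of linear forms in $A$ representing $\times\ell:A\otimes_{\mathbb{K}}N_j\to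 A\otimes_{\mathbb{K}}N_{j+1}$. Then $\mathcal{L}_{N,j}$ is defined by the ideal $I(\mathcal{L}_{N,j})$ of maximal minors of $X_j$ (the unit ideal if $N_j=0$ or $N_{j+1}=0$), and $\mathcal{L}_N=\bigcup_j\mathcal{L}_{N,j}$ is defined by $I(\mathcal{L}_N)=\bigcap_jI(\mathcal{L}_{N,j})$. Unions of such loci are defined by the intersections of the corresponding ideals. *)

theory Defs
  imports
    "HOL-Library.Poly_Mapping"
    "HOL-Computational_Algebra.Polynomial"
    "Jordan_Normal_Form.Determinant"
    "Jordan_Normal_Form.DL_Submatrix"
begin

section \<open>The polynomial ring\<close>

text \<open>
  The polynomial ring over \<open>'k\<close> in \<open>r = CARD('n)\<close> variables, indexed by the (nonempty) finite
  type \<open>'n\<close>. It serves both as \<open>S = K[x_1,...,x_r]\<close> and as the coordinate ring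
  \<open>A = K[a_1,...,a_r]\<close> of the dual projective space.
\<close>
type_synonym ('n, 'k) mpoly = "('n \<Rightarrow>\<^sub>0 nat) \<Rightarrow>\<^sub>0 'k"

definition cnst :: "'k \<Rightarrow> ('n, 'k::zero) mpoly" where
  "cnst c = Poly_Mapping.single 0 c"

definition var :: "'n \<Rightarrow> ('n, 'k::zero_neq_one) mpoly" where
  "var i = Poly_Mapping.single (Poly_Mapping.single i 1) 1"

definition homogeneous :: "nat \<Rightarrow> ('n::finite, 'k::zero) mpoly \<Rightarrow> bool" where
  "homogeneous d p \<longleftrightarrow> (\<forall>m \<in> Poly_Mapping.keys p. (\<Sum>i\<in>UNIV. Poly_Mapping.lookup m i) = d)"

definition ideal_span :: "'a::comm_ring_1 set \<Rightarrow> 'a set" where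
  "ideal_span = Modules.module.span (*)"

definition irrelevant_ideal :: "('n::finite, 'k::comm_ring_1) mpoly set" where
  "irrelevant_ideal = ideal_span (Set.range var)"


section \<open>Graded modules\<close>

text \<open>
  A module is given by its scalar multiplication on an abelian group type \<open>'m\<close>;
  \<open>kscale\<close> is the induced \<open>K\<close>-vector space structure.
\<close>
definition kscale ::
    "(('n, 'k::zero) mpoly \<Rightarrow> 'm \<Rightarrow> 'm) \<Rightarrow> 'k \<Rightarrow> 'm \<Rightarrow> 'm" where
  "kscale smul c x = smul (cnst c) x"

locale graded_module = Modules.module smul
  for smul :: "('n::finite, 'k::field) mpoly \<Rightarrow> 'm::ab_group_add \<Rightarrow> 'm" +
  fixes N :: "int \<Rightarrow> 'm set"
  assumes subspace_N: "Modules.module.subspace (kscale smul) (N j)"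
    and smul_N: "homogeneous d p \<Longrightarrow> x \<in> N j \<Longrightarrow> smul p x \<in> N (int d + j)"
    and direct_sum_N:
      "\<exists>!f. (\<forall>j. f j \<in> N j) \<and> finite {j. f j \<noteq> 0} \<and> x = (\<Sum>j | f j \<noteq> 0. f j)"

definition finitely_generated_module :: "('a::comm_ring_1 \<Rightarrow> 'm::ab_group_add \<Rightarrow> 'm) \<Rightarrow> bool" where
  "finitely_generated_module smul \<longleftrightarrow> (\<exists>B. finite B \<and> Modules.module.span smul B = UNIV)"

definition artinian_module :: "('a::comm_ring_1 \<Rightarrow> 'm::ab_group_add \<Rightarrow> 'm) \<Rightarrow> bool" where
  "artinian_module smul \<longleftrightarrow>
     (\<forall>U :: nat \<Rightarrow> 'm set. (\<forall>n. Modules.module.subspace smul (U n)) \<and> decseq U \<longrightarrow>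
        (\<exists>n. \<forall>m\<ge>n. U m = U n))"

definition nonneg_graded :: "(int \<Rightarrow> 'm::zero set) \<Rightarrow> bool" where
  "nonneg_graded N \<longleftrightarrow> (\<forall>j<0. N j = {0})"

definition socle ::
    "(('n::finite, 'k::comm_ring_1) mpoly \<Rightarrow> 'm::zero \<Rightarrow> 'm) \<Rightarrow> 'm set" where
  "socle smul = {x. \<forall>a \<in> irrelevant_ideal. smul a x = 0}"

definition max_socle_degree ::
    "(('n::finite, 'k::comm_ring_1) mpoly \<Rightarrow> 'm::zero \<Rightarrow> 'm) \<Rightarrow> (int \<Rightarrow> 'm set) \<Rightarrow> int \<Rightarrow> bool" where
  "max_socle_degree smul N c \<longleftrightarrow>
     socle smul \<inter> N c \<noteq> {0} \<and> (\<forall>j>c. socle smul \<inter> N j = {0})"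

definition level ::
    "(('n::finite, 'k::comm_ring_1) mpoly \<Rightarrow> 'm::ab_group_add \<Rightarrow> 'm) \<Rightarrow> (int \<Rightarrow> 'm set) \<Rightarrow> bool" where
  "level smul N \<longleftrightarrow>
     Modules.module.span smul (N 0) = UNIV \<and> (\<exists>c. socle smul = N c)"


section \<open>The non-Lefschetz locus as a set of points\<close>

definition max_rank_at ::
    "(('n::finite, 'k::field) mpoly \<Rightarrow> 'm::ab_group_add \<Rightarrow> 'm) \<Rightarrow> (int \<Rightarrow> 'm set) \<Rightarrow> int
      \<Rightarrow> ('n, 'k) mpoly \<Rightarrow> bool" where
  "max_rank_at smul N j l \<longleftrightarrow>
     vector_space.dim (kscale smul) (smul l ` N j) =
       min (vector_space.dim (kscale smul) (N j)) (vector_space.dim (kscale smul) (N (j + 1)))"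

definition lefschetz_element ::
    "(('n::finite, 'k::field) mpoly \<Rightarrow> 'm::ab_group_add \<Rightarrow> 'm) \<Rightarrow> (int \<Rightarrow> 'm set)
      \<Rightarrow> ('n, 'k) mpoly \<Rightarrow> bool" where
  "lefschetz_element smul N l \<longleftrightarrow> homogeneous 1 l \<and> (\<forall>j. max_rank_at smul N j l)"

text \<open>The point of \<open>P(S_1)\<close> given by a nonzero \<open>l\<close>, as the line it spans.\<close>
definition proj_point :: "('n, 'k::field) mpoly \<Rightarrow> ('n, 'k) mpoly set" where
  "proj_point l = {cnst c * l | c. True}"

definition non_lefschetz_locus_at ::
    "(('n::finite, 'k::field) mpoly \<Rightarrow> 'm::ab_group_add \<Rightarrow> 'm) \<Rightarrow> (int \<Rightarrow> 'm set) \<Rightarrow> int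
      \<Rightarrow> ('n, 'k) mpoly set set" where
  "non_lefschetz_locus_at smul N j =
     {proj_point l | l. homogeneous 1 l \<and> l \<noteq> 0 \<and> \<not> max_rank_at smul N j l}"

definition non_lefschetz_locus ::
    "(('n::finite, 'k::field) mpoly \<Rightarrow> 'm::ab_group_add \<Rightarrow> 'm) \<Rightarrow> (int \<Rightarrow> 'm set)
      \<Rightarrow> ('n, 'k) mpoly set set" where
  "non_lefschetz_locus smul N =
     {proj_point l | l. homogeneous 1 l \<and> l \<noteq> 0 \<and> \<not> lefschetz_element smul N l}"


section \<open>The scheme structure of the non-Lefschetz locus\<close>

text \<open>
  A fixed choice of an ordered \<open>K\<close>-basis of \<open>N j\<close>. One exists as soon as \<open>N j\<close> is a
  finite-dimensional subspace; the ideals of minors below do not depend on the choice.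
\<close>
definition piece_basis ::
    "(('n, 'k::field) mpoly \<Rightarrow> 'm::ab_group_add \<Rightarrow> 'm) \<Rightarrow> (int \<Rightarrow> 'm set) \<Rightarrow> int \<Rightarrow> 'm list" where
  "piece_basis smul N j =
     (SOME bs. distinct bs \<and> \<not> Modules.module.dependent (kscale smul) (set bs) \<and>
        Modules.module.span (kscale smul) (set bs) = N j)"

text \<open>
  The matrix \<open>X_j\<close> over \<open>A\<close>: with \<open>l = \<Sum>i. a_i x_i\<close>, the entry at \<open>(p, q)\<close> is
  \<open>\<Sum>i. \<lambda>_i a_i\<close>, where \<open>\<lambda>_i\<close> is the coefficient of the \<open>p\<close>-th basis vector of \<open>N (j + 1)\<close> in
  \<open>x_i\<close> times the \<open>q\<close>-th basis vector of \<open>N j\<close>. So \<open>var i\<close> is \<open>x_i\<close> inside \<open>smul\<close>, and \<open>a_i\<close>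
  outside.
\<close>
definition mult_matrix ::
    "(('n::finite, 'k::field) mpoly \<Rightarrow> 'm::ab_group_add \<Rightarrow> 'm) \<Rightarrow> (int \<Rightarrow> 'm set) \<Rightarrow> int
      \<Rightarrow> ('n, 'k) mpoly mat" where
  "mult_matrix smul N j =
     (let bs = piece_basis smul N j; cs = piece_basis smul N (j + 1) in
      mat (length cs) (length bs)
        (\<lambda>(p, q). \<Sum>i\<in>UNIV.
           cnst (Modules.module.representation (kscale smul) (set cs) (smul (var i) (bs ! q)) (cs ! p))
             * var i))"

text \<open>
  If \<open>X\<close> has no rows or no columns, its only maximal minor is the determinant of the empty
  matrix, which is \<open>1\<close>; the maximal minors then generate the unit ideal.
\<close>
definition maximal_minors :: "'a::comm_ring_1 mat \<Rightarrow> 'a set" where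
  "maximal_minors X =
     {det (submatrix X I J) | I J.
        I \<subseteq> {..<dim_row X} \<and> J \<subseteq> {..<dim_col X} \<and>
        card I = min (dim_row X) (dim_col X) \<and> card J = min (dim_row X) (dim_col X)}"

definition non_lefschetz_ideal_at ::
    "(('n::finite, 'k::field) mpoly \<Rightarrow> 'm::ab_group_add \<Rightarrow> 'm) \<Rightarrow> (int \<Rightarrow> 'm set) \<Rightarrow> int
      \<Rightarrow> ('n, 'k) mpoly set" where
  "non_lefschetz_ideal_at smul N j = ideal_span (maximal_minors (mult_matrix smul N j))"

definition non_lefschetz_ideal ::
    "(('n::finite, 'k::field) mpoly \<Rightarrow> 'm::ab_group_add \<Rightarrow> 'm) \<Rightarrow> (int \<Rightarrow> 'm set)
      \<Rightarrow> ('n, 'k) mpoly set" where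
  "non_lefschetz_ideal smul N = (\<Inter>j. non_lefschetz_ideal_at smul N j)"

end

theory Submission
  imports Defs
begin

text \<open>
  Let \<open>h\<^sub>j = dim N\<^sub>j\<close>. If some degree has no form \<open>l\<close> of maximal rank, all maximal minors of
  \<open>X\<^sub>j\<close> vanish at all points, so its ideal is zero and this \<open>j\<close> works. Otherwise let \<open>t\<close> be the
  least \<open>j \<ge> 0\<close> with \<open>h\<^sub>j \<ge> h\<^sub>j\<^sub>+\<^sub>1\<close>. Since \<open>N\<close> is generated in degree \<open>0\<close>, surjectivity of
  \<open>l : N\<^sub>j \<rightarrow> N\<^sub>j\<^sub>+\<^sub>1\<close> passes to degree \<open>j + 1\<close>; since the socle lives in degree \<open>c\<close>, injectivity
  passes from degree \<open>j + 1\<close> to \<open>j\<close>. So the Hilbert function increases up to \<open>t\<close> and decreases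
  afterwards, and maximal rank in degrees \<open>t - 1\<close> and \<open>t\<close> gives maximal rank everywhere.

  For the scheme structure, multiplication by one surjective \<open>y\<close> induces a surjection from
  \<open>coker X\<^sub>j\<close> onto \<open>coker X\<^sub>j\<^sub>+\<^sub>1\<close>, so the zeroth Fitting ideals, which are the ideals of maximal
  minors, increase for \<open>j \<ge> t\<close>. The transposed argument shows that they decrease for \<open>j < t\<close>.
\<close>

section \<open>Ideals of maximal minors\<close>

lemma module_mult: "Modules.module ((*) :: 'a::comm_ring_1 \<Rightarrow> 'a \<Rightarrow> 'a)"
  by standard (simp_all add: algebra_simps)

lemma det_comb_cols_in_ideal:
  fixes T D :: "'a::comm_ring_1 mat"
  assumes I: "Modules.module.subspace (*) I"
    and T: "T \<in> carrier_mat s m" and D: "D \<in> carrier_mat m s"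
    and minors: "\<And>f. (\<And>j. j < s \<Longrightarrow> f j < m) \<Longrightarrow> det (mat s s (\<lambda>(i, j). T $$ (i, f j))) \<in> I"
  shows "det (T * D) \<in> I"
proof -
  interpret A: Modules.module "(*) :: 'a \<Rightarrow> 'a \<Rightarrow> 'a"
    by (rule module_mult)
  let ?F = "{f. (\<forall>i\<in>{0..<s}. f i \<in> {0..<m}) \<and> (\<forall>i. i \<notin> {0..<s} \<longrightarrow> f i = i)}"
  have TD: "T * D \<in> carrier_mat s s" using T D by simp
  have T': "T\<^sup>T \<in> carrier_mat m s" and D': "D\<^sup>T \<in> carrier_mat s m" using T D by auto
  \<comment> \<open>The multilinear expansion used below is in the rows, so the product is
    transposed first.\<close>
  have "det (T * D) = det (D\<^sup>T * T\<^sup>T)"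
    using det_transpose[OF TD] transpose_mult[OF T D] by simp
  also have "\<dots> = (\<Sum>f\<in>?F. det (mat\<^sub>r s s (\<lambda>i. D\<^sup>T $$ (i, f i) \<cdot>\<^sub>v row T\<^sup>T (f i))))"
    unfolding mat_mul_finsum_alt[OF D' T'] by (rule det_linear_rows_sum) (use T in auto)
  also have "\<dots> \<in> I"
  proof (rule A.subspace_sum[OF I])
    fix f assume f: "f \<in> ?F"
    have tr: "mat\<^sub>r s s (\<lambda>i. row T\<^sup>T (f i)) = (mat s s (\<lambda>(i, j). T $$ (i, f j)))\<^sup>T"
      by (rule eq_matI) (use T f in auto)
    have "det (mat\<^sub>r s s (\<lambda>i. row T\<^sup>T (f i))) \<in> I"
      unfolding tr by (subst det_transpose[of _ s]) (use minors f in auto)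
    then show "det (mat\<^sub>r s s (\<lambda>i. D\<^sup>T $$ (i, f i) \<cdot>\<^sub>v row T\<^sup>T (f i))) \<in> I"
      by (subst det_rows_mul) (use T f in \<open>auto intro!: A.subspace_scale[OF I] simp: row_carrier_vec\<close>)
  qed
  finally show ?thesis .
qed

text \<open>Laplace expansion along the top row removes the first \<open>t\<close> rows one at a
  time. Only minors of the bottom \<open>s\<close> rows remain, and the ideal absorbs their
  coefficients.\<close>

lemma det_in_ideal_of_bottom_minors:
  fixes A :: "'a::comm_ring_1 mat"
  assumes I: "Modules.module.subspace (*) I"
    and A: "A \<in> carrier_mat (t + s) (t + s)"
    and minors: "\<And>f. (\<And>j. j < s \<Longrightarrow> f j < t + s) \<Longrightarrow>
      det (mat s s (\<lambda>(i, j). A $$ (t + i, f j))) \<in> I"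
  shows "det A \<in> I"
  using A minors
proof (induction t arbitrary: A)
  case 0
  have "mat s s (\<lambda>(i, j). A $$ (0 + i, j)) = A"
    by (rule eq_matI) (use 0 in auto)
  then show ?case using 0(2)[of "\<lambda>j. j"] by simp
next
  case (Suc t)
  interpret A: Modules.module "(*) :: 'a \<Rightarrow> 'a \<Rightarrow> 'a"
    by (rule module_mult)
  have "det (mat_delete A 0 j) \<in> I" if j: "j < Suc t + s" for j
  proof (rule Suc.IH)
    show "mat_delete A 0 j \<in> carrier_mat (t + s) (t + s)"
      using mat_delete_carrier[OF Suc.prems(1)] by simp
    fix f :: "nat \<Rightarrow> nat" assume f: "\<And>k. k < s \<Longrightarrow> f k < t + s"
    \<comment> \<open>Deleting row 0 shifts the bottom rows by one, and skipping column
      \<open>j\<close> turns the selection \<open>f\<close> into \<open>insert_index j\<close> after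
      \<open>f\<close>.\<close>
    have eq: "mat s s (\<lambda>(i, k). mat_delete A 0 j $$ (t + i, f k)) =
          mat s s (\<lambda>(i, k). A $$ (Suc t + i, insert_index j (f k)))"
      by (rule eq_matI)
        (use f j Suc.prems(1) in \<open>auto simp: mat_delete_def insert_index_def\<close>)
    show "det (mat s s (\<lambda>(i, k). mat_delete A 0 j $$ (t + i, f k))) \<in> I"
      unfolding eq
      by (rule Suc.prems(2)[of "\<lambda>k. insert_index j (f k)"])
        (use f in \<open>fastforce simp: insert_index_def\<close>)
  qed
  then have "(\<Sum>j<Suc t + s. A $$ (0, j) * cofactor A 0 j) \<in> I"
    by (intro A.subspace_sum[OF I]) (simp add: cofactor_def A.subspace_scale[OF I])
  then show ?case using laplace_expansion_row[OF Suc.prems(1), of 0] by simp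
qed

text \<open>The last row has a single nonzero entry, the corner 1; expanding along it leaves a
  matrix of the same shape with \<open>s\<close> smaller by one.\<close>

lemma det_four_block_mat_unit:
  fixes U :: "'a::comm_ring_1 mat"
  assumes U: "U \<in> carrier_mat n n" and Z: "Z \<in> carrier_mat n s"
  shows "det (four_block_mat U Z (0\<^sub>m s n) (1\<^sub>m s)) = det U"
  using Z
proof (induction s arbitrary: Z)
  case 0
  have "four_block_mat U Z (0\<^sub>m 0 n) (1\<^sub>m 0) = U"
    by (rule eq_matI) (use U 0 in auto)
  then show ?case by simp
next
  case (Suc s)
  let ?W = "four_block_mat U Z (0\<^sub>m (Suc s) n) (1\<^sub>m (Suc s))"
  let ?Z = "mat n s (\<lambda>(i, j). Z $$ (i, j))"
  have W: "?W \<in> carrier_mat (n + Suc s) (n + Suc s)" using U by (intro four_block_carrier_mat) simp_all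
  have del: "mat_delete ?W (n + s) (n + s) = four_block_mat U ?Z (0\<^sub>m s n) (1\<^sub>m s)"
    by (rule eq_matI) (use U Suc.prems in \<open>auto simp: mat_delete_def\<close>)
  have "det ?W = (\<Sum>j<n + Suc s. ?W $$ (n + s, j) * cofactor ?W (n + s) j)"
    by (rule laplace_expansion_row[OF W]) simp
  also have "\<dots> = (\<Sum>j<n + Suc s. if j = n + s then cofactor ?W (n + s) (n + s) else 0)"
    by (rule sum.cong) (use U Suc.prems in auto)
  also have "\<dots> = det (mat_delete ?W (n + s) (n + s))" by (simp add: cofactor_def)
  also have "\<dots> = det U" unfolding del by (rule Suc.IH) simp
  finally show ?case .
qed

text \<open>
  With \<open>W = (U, Z; 0, 1)\<close> and \<open>L = (1, 0; -Y, 1)\<close>, \<open>det L = 1\<close>, \<open>det W = det U\<close>, and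
  \<open>L W\<close> has bottom rows \<open>(-X V, 0)\<close>, to which Laplace expansion applies. The right inverse \<open>Z\<close>
  replaces an extension of \<open>Y\<close> to an invertible matrix.
\<close>
lemma det_in_minor_ideal_of_right_inverse:
  fixes U V X Y Z :: "'a::comm_ring_1 mat"
  assumes I: "Modules.module.subspace (*) I"
    and U: "U \<in> carrier_mat n n" and Y: "Y \<in> carrier_mat s n" and Z: "Z \<in> carrier_mat n s"
    and X: "X \<in> carrier_mat s m" and V: "V \<in> carrier_mat m n"
    and comm: "Y * U = X * V" and inv: "Y * Z = 1\<^sub>m s"
    and minors: "\<And>f. (\<And>j. j < s \<Longrightarrow> f j < m) \<Longrightarrow> det (mat s s (\<lambda>(i, j). X $$ (i, f j))) \<in> I"
  shows "det U \<in> I"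
proof -
  let ?W = "four_block_mat U Z (0\<^sub>m s n) (1\<^sub>m s)"
  let ?L = "four_block_mat (1\<^sub>m n) (0\<^sub>m n s) (- Y) (1\<^sub>m s)"
  \<comment> \<open>A column of the bottom block \<open>(- X V, 0)\<close> is \<open>X\<close> times
    a column of \<open>- V\<close>, or \<open>X\<close> times zero. \<open>?D f\<close> collects
    these right factors, so that the selected columns form a product with \<open>X\<close> on the
    left.\<close>
  let ?D = "\<lambda>f. mat m s (\<lambda>(i, j). if f j < n then - V $$ (i, f j) else 0)"
  have W: "?W \<in> carrier_mat (n + s) (n + s)" and L: "?L \<in> carrier_mat (n + s) (n + s)"
    using U by auto
  have "?L\<^sup>T = four_block_mat (1\<^sub>m n) (- Y\<^sup>T) (0\<^sub>m s n) (1\<^sub>m s)"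
    by (rule eq_matI) (use Y in auto)
  moreover have "det (four_block_mat (1\<^sub>m n) (- Y\<^sup>T) (0\<^sub>m s n) (1\<^sub>m s)) = 1"
    by (subst det_four_block_mat_unit) (use Y in auto)
  ultimately have detL: "det ?L = 1" using det_transpose[OF L] by simp
  have YZ: "- Y * Z + 1\<^sub>m s = 0\<^sub>m s s"
    using inv Y Z by (simp add: uminus_mult_left_mat)
  have LW: "?L * ?W = four_block_mat U Z (- (X * V)) (0\<^sub>m s s)"
    by (subst mult_four_block_mat[of _ n n _ s _ s _ _ n _ s])
      (use U Y Z YZ comm X V in \<open>auto simp: uminus_mult_left_mat\<close>)
  have "det (?L * ?W) \<in> I"
    unfolding LW
  proof (rule det_in_ideal_of_bottom_minors[OF I])
    show "four_block_mat U Z (- (X * V)) (0\<^sub>m s s) \<in> carrier_mat (n + s) (n + s)"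
      using U by simp
    fix f :: "nat \<Rightarrow> nat" assume f: "\<And>j. j < s \<Longrightarrow> f j < n + s"
    have fj: "f j - n < s" if "j < s" "\<not> f j < n" for j using f[of j] that by simp
    have "mat s s (\<lambda>(i, j). four_block_mat U Z (- (X * V)) (0\<^sub>m s s) $$ (n + i, f j)) = X * ?D f"
      by (rule eq_matI) (use U X V Z f fj in \<open>auto simp: scalar_prod_def sum_negf\<close>)
    moreover have "det (X * ?D f) \<in> I"
      by (rule det_comb_cols_in_ideal[OF I X _ minors]) auto
    ultimately show "det (mat s s (\<lambda>(i, j). four_block_mat U Z (- (X * V)) (0\<^sub>m s s) $$ (n + i, f j))) \<in> I"
      by simp
  qed
  then show ?thesis
    using det_mult[OF L W] detL det_four_block_mat_unit[OF U Z] by simp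
qed

section \<open>From arbitrary column selections to sets of columns\<close>

lemma finite_pick_bij:
  assumes "finite J"
  shows "bij_betw (pick J) {0..<card J} J"
proof -
  have "inj_on (pick J) {0..<card J}"
  proof (rule linorder_inj_onI)
    fix a b assume "a < b" "a \<in> {0..<card J}" "b \<in> {0..<card J}"
    then show "pick J a \<noteq> pick J b" using pick_mono[of b J a] by simp
  qed auto
  moreover have "pick J ` {0..<card J} \<subseteq> J" using pick_in_set[of _ J] by auto
  ultimately show ?thesis
    by (simp add: bij_betw_def card_image card_subset_eq assms)
qed

text \<open>With at least as many columns as rows, a maximal minor uses every row, so only the set
  of columns varies.\<close>

lemma maximal_minors_wide:
  assumes X: "X \<in> carrier_mat s m" and sm: "s \<le> m"
  shows "maximal_minors X =
    {det (mat s s (\<lambda>(i, j). X $$ (i, pick J j))) | J. J \<subseteq> {..<m} \<and> card J = s}"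
proof -
  have pick_id: "pick {..<s} i = i" if "i < s" for i
    using pick_reduce_set[of i s UNIV] that by (simp add: pick_UNIV lessThan_def)
  have "submatrix X I J = mat s s (\<lambda>(i, j). X $$ (i, pick J j))"
    if "I \<subseteq> {..<s}" "card I = s" "J \<subseteq> {..<m}" "card J = s" for I J
  proof -
    have I: "I = {..<s}" using that by (simp add: card_subset_eq)
    have "{j. j < m \<and> j \<in> J} = J" "{i. i < s \<and> i \<in> I} = {..<s}" using that I by auto
    then show ?thesis
      by (intro eq_matI) (use X that I in \<open>simp_all add: submatrix_def pick_id\<close>)
  qed
  then show ?thesis
    unfolding maximal_minors_def using X sm by (auto simp: min_absorb1) (metis card_lessThan order_refl)
qed

text \<open>Lets a matrix with more rows than columns be handled through its wide transpose:
  transposing a square submatrix keeps its determinant.\<close>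

lemma maximal_minors_transpose:
  "maximal_minors X\<^sup>T = maximal_minors (X :: 'a::comm_ring_1 mat)"
proof -
  have *: "det (submatrix X\<^sup>T J I) = det (submatrix X I J)"
    if "I \<subseteq> {..<dim_row X}" "J \<subseteq> {..<dim_col X}" "card I = card J" for I J
  proof -
    have "{i. i < dim_row X \<and> i \<in> I} = I" "{j. j < dim_col X \<and> j \<in> J} = J" using that by auto
    then have "submatrix X\<^sup>T J I = (submatrix X I J)\<^sup>T"
      and "submatrix X I J \<in> carrier_mat (card J) (card J)"
      unfolding submatrix_def
      using that pick_le[of _ "dim_row X" I] pick_le[of _ "dim_col X" J] by (auto intro!: eq_matI)
    then show ?thesis using det_transpose by metis
  qed
  show ?thesis
    unfolding maximal_minors_def
    by (auto simp: min.commute) (metis *)+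
qed

text \<open>Links the selections \<open>f\<close> of the multilinear expansion with the column sets
  in \<open>maximal_minors\<close>. A repeated column gives determinant zero; an injective
  \<open>f\<close> differs from the increasing enumeration of its image by a permutation, hence only
  by a sign.\<close>

lemma col_minor_in_ideal_span:
  fixes X :: "'a::comm_ring_1 mat"
  assumes X: "X \<in> carrier_mat s m" and sm: "s \<le> m" and f: "\<And>j. j < s \<Longrightarrow> f j < m"
  shows "det (mat s s (\<lambda>(i, j). X $$ (i, f j))) \<in> ideal_span (maximal_minors X)"
proof -
  interpret A: Modules.module "(*) :: 'a \<Rightarrow> 'a \<Rightarrow> 'a"
    by (rule module_mult)
  let ?M = "mat s s (\<lambda>(i, j). X $$ (i, f j))"
  show ?thesis
  proof (cases "inj_on f {0..<s}")
    case False
    then obtain i j where "i < s" "j < s" "i \<noteq> j" "f i = f j"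
      by (auto simp: inj_on_def)
    then have "det ?M = 0"
      by (intro det_identical_columns[of _ s i j]) (auto intro!: eq_vecI)
    then show ?thesis by (simp add: ideal_span_def A.span_zero)
  next
    case True
    define J where "J = f ` {0..<s}"
    \<comment> \<open>The permutation that sorts the selection: \<open>pick J\<close> after
      \<open>p\<close> is \<open>f\<close> on the index range, and \<open>p\<close> is the identity
      beyond it.\<close>
    define p where "p = (\<lambda>j. if j < s then the_inv_into {0..<s} (pick J) (f j) else j)"
    have J: "J \<subseteq> {..<m}" "card J = s" using f by (auto simp: J_def card_image[OF True])
    have bij: "bij_betw (pick J) {0..<s} J"
      using finite_pick_bij[of J] J by (simp add: J_def)
    have "bij_betw f {0..<s} J" using True by (simp add: J_def bij_betw_def)
    then have "bij_betw (the_inv_into {0..<s} (pick J) \<circ> f) {0..<s} {0..<s}"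
      by (rule bij_betw_trans) (rule bij_betw_the_inv_into[OF bij])
    then have "bij_betw p {0..<s} {0..<s}"
      by (rule bij_betw_cong[THEN iffD1, rotated]) (simp add: p_def)
    then have p: "p permutes {0..<s}"
      by (rule bij_imp_permutes) (simp add: p_def)
    have pick_p: "pick J (p j) = f j" if "j < s" for j
      using that f_the_inv_into_f_bij_betw[OF bij] by (simp add: p_def J_def)
    let ?P = "mat s s (\<lambda>(i, j). X $$ (i, pick J j))"
    have p_less: "p j < s" if "j < s" for j using permutes_in_image[OF p, of j] that by simp
    have "?M\<^sup>T = mat s s (\<lambda>(i, j). ?P\<^sup>T $$ (p i, j))"
      by (rule eq_matI) (auto simp: pick_p p_less)
    then have "det ?M = signof p * det ?P"
      using det_permute_rows[OF _ p, of "?P\<^sup>T"] det_transpose[of ?M s] det_transpose[of ?P s]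
      by simp
    moreover have "det ?P \<in> ideal_span (maximal_minors X)"
      unfolding ideal_span_def maximal_minors_wide[OF X sm]
      by (rule A.span_base) (use J in auto)
    ultimately show ?thesis by (auto simp: ideal_span_def intro: A.span_scale)
  qed
qed

text \<open>\<open>Y'\<close> maps the column space of \<open>X\<close> into that of
  \<open>X'\<close> and has the right inverse \<open>Z\<close>, so it induces a surjection of
  cokernels; the inclusion is the one between zeroth Fitting ideals. Each maximal minor of
  \<open>X\<close> is treated separately, paired with the same columns of \<open>Y\<close>.\<close>

lemma ideal_span_maximal_minors_mono:
  fixes X X' Y Y' Z :: "'a::comm_ring_1 mat"
  assumes X: "X \<in> carrier_mat n m" and X': "X' \<in> carrier_mat s n"
    and Y: "Y \<in> carrier_mat n m" and Y': "Y' \<in> carrier_mat s n" and Z: "Z \<in> carrier_mat n s"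
    and "n \<le> m" "s \<le> n"
    and comm: "Y' * X = X' * Y" and inv: "Y' * Z = 1\<^sub>m s"
  shows "ideal_span (maximal_minors X) \<subseteq> ideal_span (maximal_minors X')"
proof -
  interpret A: Modules.module "(*) :: 'a \<Rightarrow> 'a \<Rightarrow> 'a"
    by (rule module_mult)
  let ?cols = "\<lambda>(M :: 'a mat) J. mat n n (\<lambda>(i, j). M $$ (i, pick J j))"
  have I: "A.subspace (ideal_span (maximal_minors X'))"
    by (simp add: ideal_span_def A.subspace_span)
  have "det (?cols X J) \<in> ideal_span (maximal_minors X')" if J: "J \<subseteq> {..<m}" "card J = n" for J
  proof (rule det_in_minor_ideal_of_right_inverse[OF I _ Y' Z X' _ _ inv])
    have pick: "pick J j < m" if "j < n" for j
      using pick_in_set[of j J] that J by auto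
    have "Y' * ?cols X J = mat s n (\<lambda>(i, j). (Y' * X) $$ (i, pick J j))"
      by (rule eq_matI) (use X Y' pick in \<open>auto simp: scalar_prod_def\<close>)
    moreover have "X' * ?cols Y J = mat s n (\<lambda>(i, j). (X' * Y) $$ (i, pick J j))"
      by (rule eq_matI) (use X' Y pick in \<open>auto simp: scalar_prod_def\<close>)
    ultimately show "Y' * ?cols X J = X' * ?cols Y J" using comm by simp
  qed (use assms in \<open>auto intro: col_minor_in_ideal_span\<close>)
  then have "maximal_minors X \<subseteq> ideal_span (maximal_minors X')"
    unfolding maximal_minors_wide[OF X \<open>n \<le> m\<close>] by auto
  then show ?thesis
    using A.span_minimal[OF _ I] by (simp add: ideal_span_def)
qed


section \<open>Evaluation of polynomials\<close>

lemma cnst_simps [simp]: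
  "cnst 0 = 0" "cnst (1 :: 'k::comm_ring_1) = (1 :: ('n, 'k) mpoly)"
  by (simp_all add: cnst_def)

lemma cnst_add: "cnst (a + b) = (cnst a + cnst b :: ('n, 'k::comm_ring_1) mpoly)"
  by (simp add: cnst_def single_add)

lemma cnst_mult: "cnst (a * b) = (cnst a * cnst b :: ('n, 'k::comm_ring_1) mpoly)"
  by (simp add: cnst_def mult_single)

lemma cnst_sum: "cnst (\<Sum>i\<in>S. f i) = (\<Sum>i\<in>S. cnst (f i) :: ('n, 'k::comm_ring_1) mpoly)"
  by (induction S rule: infinite_finite_induct) (simp_all add: cnst_add)

lemma single_eq_cnst_mult_vars:
  fixes m :: "'n::finite \<Rightarrow>\<^sub>0 nat" and c :: "'k::comm_ring_1"
  shows "Poly_Mapping.single m c =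
    cnst c * (\<Prod>i\<in>UNIV. var i ^ Poly_Mapping.lookup m i)"
proof -
  have pow: "var i ^ e = (Poly_Mapping.single (Poly_Mapping.single i e) 1 :: ('n, 'k) mpoly)" for i e
    by (induction e) (simp_all add: var_def mult_single flip: single_add)
  have prod: "(\<Prod>i\<in>V. Poly_Mapping.single (g i) 1) = (Poly_Mapping.single (\<Sum>i\<in>V. g i) 1 :: ('n, 'k) mpoly)"
    if "finite V" for V and g :: "'n \<Rightarrow> 'n \<Rightarrow>\<^sub>0 nat"
    using that by (induction V rule: finite_induct) (simp_all add: mult_single)
  have "(\<Sum>i\<in>UNIV. Poly_Mapping.single i (Poly_Mapping.lookup m i)) = m"
    by (rule poly_mapping_eqI) (simp add: lookup_sum lookup_single when_def)
  then show ?thesis by (simp add: pow prod cnst_def mult_single)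
qed

lemma mpoly_sum_monomials:
  "p = (\<Sum>m\<in>Poly_Mapping.keys p. Poly_Mapping.single m (Poly_Mapping.lookup p m))"
  by (rule poly_mapping_eqI)
    (simp add: lookup_sum lookup_single when_def in_keys_iff)

text \<open>Constants and variables generate the ring: products give the monomials, and sums of
  monomials give all polynomials.\<close>

lemma mpoly_induct [case_names const var add mult]:
  fixes p :: "('n::finite, 'k::comm_ring_1) mpoly"
  assumes const: "\<And>c. P (cnst c)" and var: "\<And>i. P (var i)"
    and add: "\<And>p q. P p \<Longrightarrow> P q \<Longrightarrow> P (p + q)" and mult: "\<And>p q. P p \<Longrightarrow> P q \<Longrightarrow> P (p * q)"
  shows "P p"
proof -
  have one: "P 1" using const[of 1] by simp
  have zero: "P 0" using const[of 0] by simp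
  have pow: "P (q ^ e)" if "P q" for q e
    by (induction e) (simp_all add: one mult that)
  have prod: "P (\<Prod>i\<in>V. g i)" if "finite V" "\<And>i. P (g i)" for V :: "'n set" and g
    using that(1) by (induction V rule: finite_induct) (simp_all add: one mult that(2))
  have single: "P (Poly_Mapping.single m c)" for m c
    unfolding single_eq_cnst_mult_vars by (intro mult const prod pow var finite)
  have "P (\<Sum>m\<in>K. Poly_Mapping.single m (Poly_Mapping.lookup p m))" if "finite K" for K
    using that by (induction K rule: finite_induct) (simp_all add: zero add single)
  from this[OF finite_keys[of p]] show ?thesis by (simp only: mpoly_sum_monomials[symmetric])
qed

section \<open>Evaluation at a point, and polynomials as functions\<close>

definition eval_at :: "('n::finite \<Rightarrow> 'k) \<Rightarrow> ('n, 'k::comm_ring_1) mpoly \<Rightarrow> 'k" where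
  "eval_at a p = (\<Sum>m\<in>Poly_Mapping.keys p.
     Poly_Mapping.lookup p m * (\<Prod>i\<in>UNIV. a i ^ Poly_Mapping.lookup m i))"

lemma eval_at_superset:
  assumes "finite K" "Poly_Mapping.keys p \<subseteq> K"
  shows "eval_at a p = (\<Sum>m\<in>K. Poly_Mapping.lookup p m * (\<Prod>i\<in>UNIV. a i ^ Poly_Mapping.lookup m i))"
  unfolding eval_at_def
  by (rule sum.mono_neutral_left) (use assms in \<open>auto simp: in_keys_iff\<close>)

lemma eval_at_single:
  "eval_at a (Poly_Mapping.single m c) = c * (\<Prod>i\<in>UNIV. a i ^ Poly_Mapping.lookup m i)"
  by (subst eval_at_superset[of "{m}"]) auto

lemma eval_at_cnst [simp]: "eval_at a (cnst c) = c"
  by (simp add: cnst_def eval_at_single)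

lemma eval_at_var [simp]: "eval_at a (var i) = a i"
proof -
  have "(\<Prod>j\<in>UNIV. a j ^ Poly_Mapping.lookup (Poly_Mapping.single i 1) j) = (\<Prod>j\<in>UNIV. if j = i then a j else 1)"
    by (rule prod.cong) (auto simp: lookup_single when_def)
  then show ?thesis by (simp add: var_def eval_at_single)
qed

lemma eval_at_add: "eval_at a (p + q) = eval_at a p + eval_at a q"
proof -
  let ?K = "Poly_Mapping.keys p \<union> Poly_Mapping.keys q"
  have "Poly_Mapping.keys (p + q) \<subseteq> ?K" by (rule keys_add)
  then show ?thesis
    by (simp add: eval_at_superset[of ?K] lookup_add algebra_simps sum.distrib)
qed

lemma eval_at_zero [simp]: "eval_at a 0 = 0"
  by (simp add: eval_at_def)

lemma eval_at_sum: "eval_at a (\<Sum>i\<in>S. f i) = (\<Sum>i\<in>S. eval_at a (f i))"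
  by (induction S rule: infinite_finite_induct) (simp_all add: eval_at_add)

lemma eval_at_mult: "eval_at a (p * q) = eval_at a p * eval_at a q"
proof -
  have "eval_at a (Poly_Mapping.single m c * Poly_Mapping.single m' c') =
      eval_at a (Poly_Mapping.single m c) * eval_at a (Poly_Mapping.single m' c')" for m m' c c'
    by (simp add: mult_single eval_at_single lookup_add power_add prod.distrib algebra_simps)
  then have "eval_at a ((\<Sum>m\<in>K. Poly_Mapping.single m (f m)) * (\<Sum>m\<in>K'. Poly_Mapping.single m (f' m))) =
      eval_at a (\<Sum>m\<in>K. Poly_Mapping.single m (f m)) * eval_at a (\<Sum>m\<in>K'. Poly_Mapping.single m (f' m))"
    for K K' f f'
    by (simp add: sum_product eval_at_sum)
  from this[where K = "Poly_Mapping.keys p" and f = "Poly_Mapping.lookup p"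
      and K' = "Poly_Mapping.keys q" and f' = "Poly_Mapping.lookup q"]
  show ?thesis by (simp only: mpoly_sum_monomials[symmetric])
qed

lemma comm_ring_hom_eval_at: "comm_ring_hom (eval_at a)"
  by standard (simp_all add: eval_at_add eval_at_mult eval_at_cnst[of a 1, simplified])

text \<open>Induction on the variables: group the terms by the exponent of \<open>v\<close> and view
  the sum as a univariate polynomial in the value at \<open>v\<close>. The exponents are functions
  on all of \<open>'n\<close>, so the separation hypothesis says that the variables in
  \<open>V\<close> alone tell the terms apart.\<close>

lemma coeffs_zero_of_vanishing:
  fixes c :: "('n \<Rightarrow> nat) \<Rightarrow> 'k::field_char_0"
  assumes "finite V" "finite F"
    and "\<And>f g. f \<in> F \<Longrightarrow> g \<in> F \<Longrightarrow> \<forall>i\<in>V. f i = g i \<Longrightarrow> f = g"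
    and "\<And>a. (\<Sum>f\<in>F. c f * (\<Prod>i\<in>V. a i ^ f i)) = 0"
    and "f \<in> F"
  shows "c f = 0"
  using assms
proof (induction V arbitrary: F f rule: finite_induct)
  case empty
  then have "F = {f}" by auto
  then show ?case using empty.prems(3) by simp
next
  case (insert v V)
  let ?G = "\<lambda>k. {g \<in> F. g v = k}"
  have "(\<Sum>g\<in>?G (f v). c g * (\<Prod>i\<in>V. a i ^ g i)) = 0" for a
  proof -
    define q where "q = (\<Sum>g\<in>F. monom (c g * (\<Prod>i\<in>V. a i ^ g i)) (g v))"
    have "poly q t = 0" for t
    proof -
      have "poly q t = (\<Sum>g\<in>F. c g * (\<Prod>i\<in>insert v V. (a(v := t)) i ^ g i))"
        unfolding q_def poly_sum
      proof (rule sum.cong)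
        fix g
        have "(\<Prod>i\<in>V. (a(v := t)) i ^ g i) = (\<Prod>i\<in>V. a i ^ g i)"
          by (rule prod.cong) (use insert.hyps in auto)
        then show "poly (monom (c g * (\<Prod>i\<in>V. a i ^ g i)) (g v)) t =
            c g * (\<Prod>i\<in>insert v V. (a(v := t)) i ^ g i)"
          using insert.hyps by (simp add: poly_monom)
      qed simp
      then show ?thesis using insert.prems(3) by simp
    qed
    \<comment> \<open>A field of characteristic zero is infinite, so a univariate polynomial that
      vanishes everywhere is zero.\<close>
    then have "q = 0" by (simp add: poly_eq_poly_eq_iff[symmetric] fun_eq_iff)
    then have "coeff q (f v) = 0" by simp
    moreover have "coeff q (f v) = (\<Sum>g\<in>F. if g v = f v then c g * (\<Prod>i\<in>V. a i ^ g i) else 0)"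
      by (auto simp: q_def coeff_sum intro: sum.cong)
    ultimately show ?thesis using insert.prems(1) by (simp add: sum.inter_filter)
  qed
  \<comment> \<open>Members of \<open>?G (f v)\<close> share the exponent of \<open>v\<close>, so
    distinct ones are already separated by \<open>V\<close>.\<close>
  then show ?case
    by (intro insert.IH[of "?G (f v)"]) (use insert.prems in auto)
qed

text \<open>Supplies a point at which a given nonzero minor does not vanish.\<close>

lemma mpoly_eq_zero_if_eval_at_zero:
  fixes p :: "('n::finite, 'k::field_char_0) mpoly"
  assumes "\<And>a. eval_at a p = 0"
  shows "p = 0"
proof (rule poly_mapping_eqI)
  fix m
  let ?F = "Poly_Mapping.lookup ` Poly_Mapping.keys p"
  let ?c = "\<lambda>f. Poly_Mapping.lookup p (Poly_Mapping.Abs_poly_mapping f)"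
  have "(\<Sum>f\<in>?F. ?c f * (\<Prod>i\<in>UNIV. a i ^ f i)) = eval_at a p" for a
    unfolding eval_at_def
    by (subst sum.reindex) (auto simp: inj_on_def poly_mapping_eqI)
  then have "?c (Poly_Mapping.lookup m) = 0" if "m \<in> Poly_Mapping.keys p"
    using that assms
    by (intro coeffs_zero_of_vanishing[of UNIV ?F ?c "Poly_Mapping.lookup m"]) (auto simp: fun_eq_iff)
  then show "Poly_Mapping.lookup p m = Poly_Mapping.lookup 0 m"
    by (cases "m \<in> Poly_Mapping.keys p") (auto simp: in_keys_iff)
qed


section \<open>Level modules\<close>

lemma homogeneous_cnst: "homogeneous 0 (cnst c)"
  by (auto simp: homogeneous_def cnst_def split: if_splits)

lemma homogeneous_var: "homogeneous 1 (var i :: ('n::finite, 'k::zero_neq_one) mpoly)"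
  by (simp add: homogeneous_def var_def lookup_single when_def)

lemma homogeneous_add: "homogeneous d p \<Longrightarrow> homogeneous d q \<Longrightarrow> homogeneous d (p + q)"
  using keys_add[of p q] unfolding homogeneous_def by blast

lemma homogeneous_linear_form:
  "homogeneous 1 (\<Sum>i\<in>UNIV. cnst (a i) * var i :: ('n::finite, 'k::comm_ring_1) mpoly)"
proof -
  have "homogeneous 1 (cnst c * var i :: ('n, 'k) mpoly)" for c i
    using homogeneous_var[where 'k = 'k, of i]
    by (auto simp: homogeneous_def cnst_def var_def mult_single lookup_single when_def split: if_splits)
  note h = this
  have "homogeneous 1 (\<Sum>i\<in>V. cnst (a i) * var i :: ('n, 'k) mpoly)" if "finite V" for V
    using that by (induction V rule: finite_induct) (simp_all add: homogeneous_add h[unfolded One_nat_def], simp add: homogeneous_def)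
  then show ?thesis by simp
qed

section \<open>Homogeneous components and submodules\<close>

context graded_module
begin

sublocale V: vector_space "kscale smul"
  by unfold_locales
    (simp_all add: kscale_def cnst_add cnst_mult scale_left_distrib scale_right_distrib)

sublocale VP: vector_space_pair "kscale smul" "kscale smul" ..

lemma linear_smul: "Vector_Spaces.linear (kscale smul) (kscale smul) (smul p)"
  by (simp add: Vector_Spaces.linear_iff V.vector_space_axioms)
    (simp add: kscale_def scale_right_distrib mult.commute)

lemma zero_in_N: "0 \<in> N j"
  using subspace_N by (rule V.subspace_0)

definition component :: "'m \<Rightarrow> int \<Rightarrow> 'm" where
  "component x = (THE f. (\<forall>j. f j \<in> N j) \<and> finite {j. f j \<noteq> 0} \<and> x = (\<Sum>j | f j \<noteq> 0. f j))"

lemma component: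
  "component x j \<in> N j" "finite {j. component x j \<noteq> 0}" "x = (\<Sum>j | component x j \<noteq> 0. component x j)"
  using theI'[OF direct_sum_N[of x]] unfolding component_def by blast+

lemma component_eqI:
  assumes "\<And>j. f j \<in> N j" "finite A" "\<And>j. j \<notin> A \<Longrightarrow> f j = 0" "x = (\<Sum>j\<in>A. f j)"
  shows "component x = f"
proof -
  have sub: "{j. f j \<noteq> 0} \<subseteq> A" using assms(3) by auto
  have "(\<Sum>j | f j \<noteq> 0. f j) = (\<Sum>j\<in>A. f j)"
    by (rule sum.mono_neutral_left) (use assms sub in auto)
  then show ?thesis
    unfolding component_def
    by (intro the1_equality[OF direct_sum_N]) (use assms sub finite_subset in auto)
qed

lemma component_homogeneous:
  "x \<in> N i \<Longrightarrow> component x = (\<lambda>j. if j = i then x else 0)"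
  by (rule component_eqI[of _ "{i}"]) (auto simp: zero_in_N)

lemma N_disjoint: "x \<in> N i \<Longrightarrow> x \<in> N j \<Longrightarrow> i \<noteq> j \<Longrightarrow> x = 0"
  using component_homogeneous[of x i] component_homogeneous[of x j] fun_cong[of _ _ i] by metis

lemma component_add: "component (x + y) = (\<lambda>j. component x j + component y j)"
proof (rule component_eqI)
  let ?A = "{j. component x j \<noteq> 0} \<union> {j. component y j \<noteq> 0}"
  show "finite ?A" using component(2) by simp
  have "(\<Sum>j\<in>?A. component z j) = z" if "z \<in> {x, y}" for z
    by (subst (2) component(3)[of z], rule sum.mono_neutral_right)
      (use component(2)[of x] component(2)[of y] that in auto)
  then show "x + y = (\<Sum>j\<in>?A. component x j + component y j)" by (simp add: sum.distrib)
qed (use component(1) subspace_N V.subspace_add in auto)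

lemma component_smul:
  assumes "homogeneous d p"
  shows "component (smul p x) = (\<lambda>j. smul p (component x (j - int d)))"
proof (rule component_eqI)
  let ?A = "{j. component x j \<noteq> 0}"
  let ?B = "(\<lambda>j. j + int d) ` ?A"
  show "smul p (component x (j - int d)) \<in> N j" for j
    using smul_N[OF assms component(1)[of x "j - int d"]] by simp
  show "finite ?B" using component(2) by simp
  show "smul p (component x (j - int d)) = 0" if "j \<notin> ?B" for j
  proof -
    have "component x (j - int d) = 0"
      using that by (force simp: image_iff)
    then show ?thesis by simp
  qed
  have "smul p x = (\<Sum>j\<in>?A. smul p (component x j))"
    by (subst component(3)[of x]) (rule scale_sum_right)
  also have "\<dots> = (\<Sum>j\<in>?B. smul p (component x (j - int d)))"
    by (subst sum.reindex) auto
  finally show "smul p x = (\<Sum>j\<in>?B. smul p (component x (j - int d)))" .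
qed

text \<open>Constants and variables generate the ring, so stability under them is stability under
  all polynomials. This turns linear conditions on components into submodules that can be compared
  with generators.\<close>

lemma V_subspace_smul_closed_imp_subspace:
  assumes "V.subspace U" and "\<And>i x. x \<in> U \<Longrightarrow> smul (var i) x \<in> U"
  shows "subspace U"
proof -
  have "\<forall>x\<in>U. smul p x \<in> U" for p
    by (induction p rule: mpoly_induct)
      (use assms V.subspace_scale[OF assms(1)] V.subspace_add[OF assms(1)]
        in \<open>auto simp: kscale_def scale_left_distrib simp flip: scale_scale\<close>)
  then show ?thesis
    using assms(1) by (auto simp: subspace_def V.subspace_def)
qed

lemma subspace_component_in:
  assumes "V.subspace W"
  shows "V.subspace {x. component x j \<in> W}"
proof -
  have "component 0 j = 0" using component_homogeneous[OF zero_in_N, of j] by simp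
  moreover have "component (kscale smul c x) j = kscale smul c (component x j)" for c x
    using component_smul[OF homogeneous_cnst, of c x] by (simp add: kscale_def)
  ultimately show ?thesis
    using V.subspace_0[OF assms] V.subspace_add[OF assms] V.subspace_scale[OF assms]
    by (simp add: V.subspace_def component_add)
qed

end

text \<open>Here \<open>c\<close> is the degree in which the socle sits. That all pieces above
  \<open>c\<close> vanish and that the module is finite dimensional are derived below.\<close>

locale level_module = graded_module smul N
  for smul :: "('n::finite, 'k::field_char_0) mpoly \<Rightarrow> 'm::ab_group_add \<Rightarrow> 'm" and N +
  fixes c :: int
  assumes fg: "finitely_generated_module smul"
    and nonneg: "nonneg_graded N"
    and span_N0: "span (N 0) = UNIV"
    and socle_eq: "socle smul = N c"
    and Nc_nonzero: "N c \<noteq> {0}"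
begin

section \<open>The graded pieces of a level module\<close>

lemma N_neg: "j < 0 \<Longrightarrow> N j = {0}"
  using nonneg by (simp add: nonneg_graded_def)

lemma c_nonneg: "c \<ge> 0"
  using Nc_nonzero N_neg[of c] by force

lemma var_N: "x \<in> N j \<Longrightarrow> smul (var i) x \<in> N (j + 1)"
  using smul_N[OF homogeneous_var, of x j] by (simp add: add.commute)

text \<open>The elements whose component in degree \<open>j + 1\<close> lies in the span of the
  products form a submodule; it contains the generators \<open>N 0\<close>, so it is
  everything.\<close>

lemma N_Suc:
  assumes "j \<ge> 0"
  shows "N (j + 1) = V.span (\<Union>i. smul (var i) ` N j)" (is "_ = V.span ?S")
proof
  let ?U = "{x. component x (j + 1) \<in> V.span ?S}"
  have "subspace ?U"
  proof (rule V_subspace_smul_closed_imp_subspace)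
    show "V.subspace ?U" by (rule subspace_component_in) (rule V.subspace_span)
    show "smul (var i) x \<in> ?U" for i x
      using component(1)[of x j] component_smul[OF homogeneous_var, of i x]
      by (auto intro!: V.span_base)
  qed
  moreover have "N 0 \<subseteq> ?U"
    \<comment> \<open>Since \<open>j \<ge> 0\<close>, the degree \<open>j + 1\<close> is not 0, so
      elements of \<open>N 0\<close> have zero component there.\<close>
    using component_homogeneous[of _ 0] assms V.span_zero by auto
  ultimately have U: "component x (j + 1) \<in> V.span ?S" for x
    using span_minimal[of "N 0" ?U] span_N0 by auto
  show "N (j + 1) \<subseteq> V.span ?S"
  proof
    fix x assume "x \<in> N (j + 1)"
    then show "x \<in> V.span ?S" using U[of x] component_homogeneous[of x "j + 1"] by simp
  qed
  show "V.span ?S \<subseteq> N (j + 1)"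
    by (rule V.span_minimal) (use var_N subspace_N in auto)
qed

text \<open>The components in degree 0 of finitely many generators suffice: a multiple by a variable
  gets its component in degree 0 from degree -1, where the module is zero.\<close>

lemma N0_finite: "\<exists>B. finite B \<and> N 0 \<subseteq> V.span B"
proof -
  obtain B where B: "finite B" "span B = UNIV" using fg by (auto simp: finitely_generated_module_def)
  let ?B = "(\<lambda>b. component b 0) ` B"
  let ?U = "{x. component x 0 \<in> V.span ?B}"
  have "subspace ?U"
  proof (rule V_subspace_smul_closed_imp_subspace)
    show "V.subspace ?U" by (rule subspace_component_in) (rule V.subspace_span)
    show "smul (var i) x \<in> ?U" for i x
      using component(1)[of x "-1"] component_smul[OF homogeneous_var, of i x] N_neg[of "-1"]
      by (auto simp: V.span_zero)
  qed
  moreover have "B \<subseteq> ?U" by (auto intro: V.span_base)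
  ultimately have U: "component x 0 \<in> V.span ?B" for x
    using span_minimal[of B ?U] B(2) by auto
  have "N 0 \<subseteq> V.span ?B"
  proof
    fix x assume "x \<in> N 0"
    then show "x \<in> V.span ?B" using U[of x] component_homogeneous[of x 0] by simp
  qed
  then show ?thesis using B(1) by blast
qed

lemma N_finite: "\<exists>B. finite B \<and> N j \<subseteq> V.span B"
proof (cases "j \<ge> 0")
  case True
  then show ?thesis
  proof (induction j rule: int_ge_induct)
    case base
    show ?case by (rule N0_finite)
  next
    case (step j)
    then obtain B where B: "finite B" "N j \<subseteq> V.span B" by auto
    let ?B = "\<Union>i. smul (var i) ` B"
    have "smul (var i) ` N j \<subseteq> V.span ?B" for i
    proof -
      have "smul (var i) ` N j \<subseteq> smul (var i) ` V.span B" using B by blast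
      also have "\<dots> = V.span (smul (var i) ` B)"
        using VP.linear_span_image[OF linear_smul] by simp
      also have "\<dots> \<subseteq> V.span ?B" by (rule V.span_mono) auto
      finally show ?thesis .
    qed
    then have "N (j + 1) \<subseteq> V.span ?B"
      unfolding N_Suc[OF step(1)] by (intro V.span_minimal V.subspace_span) auto
    moreover have "finite ?B" using B(1) by simp
    ultimately show ?case by blast
  qed
next
  case False
  then show ?thesis using N_neg[of j] by (intro exI[of _ "{}"]) auto
qed

text \<open>The variables kill the socle \<open>N c\<close>, so generation from the previous degree
  gives \<open>N (c + 1) = {0}\<close>, and the zero propagates upwards.\<close>

lemma N_above_c:
  assumes "j > c"
  shows "N j = {0}"
proof -
  have "var i \<in> (irrelevant_ideal :: ('n, 'k) mpoly set)" for i
  proof -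
    interpret A: Modules.module "(*) :: ('n, 'k) mpoly \<Rightarrow> _ \<Rightarrow> _"
      by (rule module_mult)
    show ?thesis unfolding irrelevant_ideal_def ideal_span_def by (rule A.span_base) simp
  qed
  then have "smul (var i) x = 0" if "x \<in> N c" for i x
    using that socle_eq by (auto simp: socle_def)
  then have "(\<Union>i. smul (var i) ` N c) = {0}" using zero_in_N[of c] by auto
  then have base: "N (c + 1) = {0}" using N_Suc[OF c_nonneg] by simp
  have "c + 1 \<le> j" using assms by simp
  then show ?thesis
  proof (induction j rule: int_ge_induct)
    case base
    show ?case by fact
  next
    case (step j)
    then have "N (j + 1) = V.span (\<Union>i. smul (var i) ` {0})" using N_Suc[of j] c_nonneg by simp
    then show ?case by simp
  qed
qed

text \<open>The annihilator of \<open>x\<close> is an ideal containing the variables, so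
  \<open>x\<close> is in the socle \<open>N c\<close>; an element of two different degrees is
  zero.\<close>

lemma socle_below_c:
  assumes "j < c" "x \<in> N j" "\<And>i. smul (var i) x = 0"
  shows "x = 0"
proof -
  interpret A: Modules.module "(*) :: ('n, 'k) mpoly \<Rightarrow> _ \<Rightarrow> _"
    by (rule module_mult)
  have "A.subspace {a. smul a x = 0}"
    by (auto simp: A.subspace_def scale_left_distrib simp flip: scale_scale)
  then have "irrelevant_ideal \<subseteq> {a. smul a x = 0}"
    unfolding irrelevant_ideal_def ideal_span_def
    by (intro A.span_minimal) (use assms(3) in auto)
  then have "x \<in> N c" unfolding socle_eq[symmetric] by (auto simp: socle_def)
  then show ?thesis using N_disjoint[of x j c] assms by simp
qed

lemma finite_dimensional: "\<exists>B. finite_dimensional_vector_space (kscale smul) B"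
proof -
  obtain B where B: "\<And>j. finite (B j)" "\<And>j. N j \<subseteq> V.span (B j)" using N_finite by metis
  let ?B = "\<Union>j\<in>{0..c}. B j"
  have "component x j \<in> V.span ?B" for x j
  proof (cases "j \<in> {0..c}")
    case True
    then have "V.span (B j) \<subseteq> V.span ?B" by (intro V.span_mono) auto
    then show ?thesis using component(1)[of x j] B(2)[of j] by auto
  next
    case False
    then have "N j = {0}" using N_neg N_above_c by auto
    then show ?thesis using component(1)[of x j] V.span_zero by auto
  qed
  then have "x \<in> V.span ?B" for x
    by (subst component(3)[of x]) (rule V.span_sum)
  then have span: "V.span ?B = UNIV" by auto
  obtain C where C: "C \<subseteq> ?B" "V.independent C" "?B \<subseteq> V.span C"
    using V.maximal_independent_subset[of ?B] by blast
  have "V.span C = UNIV" using C(3) span V.span_minimal[OF C(3) V.subspace_span] by auto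
  moreover have "finite C" using C(1) B(1) by (auto intro: finite_subset)
  ultimately have "finite_dimensional_vector_space (kscale smul) C"
    using C(2) by unfold_locales
  then show ?thesis by blast
qed

section \<open>Maximal rank as surjectivity or injectivity, and its passage between degrees\<close>

lemma smul_linear_form_N:
  "homogeneous 1 l \<Longrightarrow> x \<in> N j \<Longrightarrow> smul l x \<in> N (j + 1)"
  using smul_N[of 1 l x j] by (simp add: add.commute)

lemma max_rank_at_iff_surj:
  assumes "homogeneous 1 l" "V.dim (N (j + 1)) \<le> V.dim (N j)"
  shows "max_rank_at smul N j l \<longleftrightarrow> smul l ` N j = N (j + 1)"
proof -
  obtain B where "finite_dimensional_vector_space (kscale smul) B" using finite_dimensional by blast
  then interpret F: finite_dimensional_vector_space "kscale smul" B .
  have "smul l ` N j \<subseteq> N (j + 1)" using assms(1) smul_linear_form_N by auto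
  moreover have "V.subspace (smul l ` N j)"
    by (rule VP.linear_subspace_image[OF linear_smul subspace_N])
  ultimately show ?thesis
    using F.subspace_dim_equal[of "smul l ` N j" "N (j + 1)"] subspace_N assms(2)
    by (auto simp: max_rank_at_def min_absorb2)
qed

lemma dim_le_of_surj:
  assumes "smul l ` N j = N (j + 1)"
  shows "V.dim (N (j + 1)) \<le> V.dim (N j)"
proof -
  obtain B where B: "B \<subseteq> N j" "V.independent B" "N j \<subseteq> V.span B" "card B = V.dim (N j)"
    using V.basis_exists by blast
  obtain C where "finite_dimensional_vector_space (kscale smul) C" using finite_dimensional by blast
  then interpret F: finite_dimensional_vector_space "kscale smul" C .
  have "finite B" using F.finiteI_independent B by blast
  have "N (j + 1) \<subseteq> V.span (smul l ` B)"
    using assms B(3) VP.linear_span_image[OF linear_smul] by blast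
  then have "V.dim (N (j + 1)) \<le> card (smul l ` B)"
    by (rule V.dim_le_card) (use \<open>finite B\<close> in simp)
  also have "\<dots> \<le> V.dim (N j)" using card_image_le[OF \<open>finite B\<close>] B(4) by metis
  finally show ?thesis .
qed

lemma max_rank_at_iff_inj:
  assumes "homogeneous 1 l" "V.dim (N j) \<le> V.dim (N (j + 1))"
  shows "max_rank_at smul N j l \<longleftrightarrow> inj_on (smul l) (N j)"
proof -
  obtain C where "finite_dimensional_vector_space (kscale smul) C" using finite_dimensional by blast
  then interpret F: finite_dimensional_vector_space "kscale smul" C .
  obtain B where B: "B \<subseteq> N j" "V.independent B" "N j \<subseteq> V.span B" "card B = V.dim (N j)"
    using V.basis_exists by blast
  have fin: "finite B" using F.finiteI_independent B by blast
  have spanB: "V.span B = N j" using B(1,3) V.span_minimal subspace_N by blast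
  have img: "smul l ` N j = V.span (smul l ` B)"
    using VP.linear_span_image[OF linear_smul, of l B] spanB by simp
  have "inj_on (smul l) (N j)" if "V.dim (smul l ` N j) = V.dim (N j)"
  proof -
    have dim: "V.dim (smul l ` B) = card B" using that B(4) by (simp add: img)
    have "card (smul l ` B) \<le> card B" using fin by (rule card_image_le)
    \<comment> \<open>A spanning set with no more elements than the dimension is
      independent.\<close>
    then have "V.independent (smul l ` B)"
      by (intro F.card_le_dim_spanning[of _ "smul l ` B"]) (use fin dim V.span_superset in auto)
    then have "card (smul l ` B) = card B"
      using dim V.dim_eq_card_independent by simp
    then have "inj_on (smul l) B" using fin by (simp add: eq_card_imp_inj_on)
    then show ?thesis
      using VP.linear_inj_on_span_iff_independent_image[OF linear_smul \<open>V.independent (smul l ` B)\<close>] spanB by simp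
  qed
  moreover have "V.dim (smul l ` N j) = V.dim (N j)" if "inj_on (smul l) (N j)"
  proof -
    have "V.independent (smul l ` B)"
      using VP.linear_independent_injective_image[OF linear_smul B(2)] that spanB by simp
    moreover have "card (smul l ` B) = card B"
      using that B(1) by (intro card_image) (rule inj_on_subset)
    ultimately show ?thesis using img B(4) V.dim_span_eq_card_independent by simp
  qed
  ultimately show ?thesis using assms(2) by (auto simp: max_rank_at_def min_absorb1)
qed

text \<open>\<open>N (j + 2)\<close> is spanned by the products of variables with elements
  \<open>l z\<close> of \<open>N (j + 1)\<close>, and the variable can be moved inside:
  \<open>x_i (l z) = l (x_i z)\<close>.\<close>

lemma surj_step:
  assumes "homogeneous 1 l" "j \<ge> 0" and surj: "smul l ` N j = N (j + 1)"
  shows "smul l ` N (j + 1) = N (j + 2)"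
proof
  show "smul l ` N (j + 1) \<subseteq> N (j + 2)" using smul_linear_form_N[OF assms(1), of _ "j + 1"] by (auto simp: add.commute)
  have "smul (var i) x \<in> smul l ` N (j + 1)" if x: "x \<in> N (j + 1)" for i x
  proof -
    obtain z where "z \<in> N j" "x = smul l z" using surj x by blast
    then have "smul (var i) x = smul l (smul (var i) z)" "smul (var i) z \<in> N (j + 1)"
      using var_N by (simp_all add: mult.commute)
    then show ?thesis by blast
  qed
  then have "V.span (\<Union>i. smul (var i) ` N (j + 1)) \<subseteq> smul l ` N (j + 1)"
    by (intro V.span_minimal VP.linear_subspace_image[OF linear_smul subspace_N]) auto
  then show "N (j + 2) \<subseteq> smul l ` N (j + 1)"
    using N_Suc[of "j + 1"] assms(2) by (simp add: add.assoc)
qed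

text \<open>If \<open>l x = 0\<close>, then \<open>l\<close> kills every \<open>x_i x\<close>, which
  is then zero by injectivity one degree higher. So \<open>x\<close> is a socle element below degree
  \<open>c\<close>.\<close>

lemma inj_step:
  assumes "homogeneous 1 l" "j < c" and inj: "inj_on (smul l) (N (j + 1))"
  shows "inj_on (smul l) (N j)"
proof -
  have "x = 0" if x: "x \<in> N j" "smul l x = 0" for x
  proof (rule socle_below_c[OF \<open>j < c\<close> x(1)])
    fix i
    have "smul l (smul (var i) x) = smul (var i) (smul l x)" by (simp add: mult.commute)
    then have "smul l (smul (var i) x) = smul l 0" using x by simp
    then show "smul (var i) x = 0"
      using inj_onD[OF inj] var_N x(1) zero_in_N by blast
  qed
  then show ?thesis
    using VP.linear_inj_on_iff_eq_0[OF linear_smul subspace_N] by blast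
qed

end


section \<open>Matrices of multiplication maps\<close>

lemma right_inverse_of_minor:
  fixes M :: "'k::field mat"
  assumes M: "M \<in> carrier_mat s m" and f: "\<And>j. j < s \<Longrightarrow> f j < m"
    and det: "det (mat s s (\<lambda>(i, j). M $$ (i, f j))) \<noteq> 0"
  obtains Z where "Z \<in> carrier_mat m s" "M * Z = 1\<^sub>m s"
proof -
  let ?C = "mat s s (\<lambda>(i, j). M $$ (i, f j))"
  \<comment> \<open>The matrix that selects the columns \<open>f\<close>, so
    \<open>M * ?E = ?C\<close>; the right inverse is \<open>?E\<close> times the inverse of
    \<open>?C\<close>.\<close>
  let ?E = "mat m s (\<lambda>(k, j). if k = f j then 1 else 0)"
  have C: "?C \<in> carrier_mat s s" by simp
  obtain W where W: "W \<in> carrier_mat s s" "?C * W = 1\<^sub>m s"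
    using det_non_zero_imp_unit[OF C det, of "()"] by (auto simp: Units_def ring_mat_def)
  have "M * ?E = ?C"
    by (rule eq_matI) (use M f in \<open>auto simp: scalar_prod_def if_distrib cong: if_cong\<close>)
  then have "M * (?E * W) = 1\<^sub>m s"
    using assoc_mult_mat[OF M _ W(1), of ?E] W(2) by simp
  then show ?thesis by (rule that[OF mult_carrier_mat[OF mat_carrier W(1)]])
qed

context level_module
begin

section \<open>Coordinates and one-sided inverses\<close>

abbreviation pb :: "int \<Rightarrow> 'm list" where
  "pb \<equiv> piece_basis smul N"

lemma piece_basis:
  "distinct (pb j)" "V.independent (set (pb j))" "V.span (set (pb j)) = N j"
proof -
  obtain C where "finite_dimensional_vector_space (kscale smul) C" using finite_dimensional by blast
  then interpret F: finite_dimensional_vector_space "kscale smul" C .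
  obtain B where B: "B \<subseteq> N j" "V.independent B" "N j \<subseteq> V.span B"
    using V.basis_exists[of "N j"] by metis
  have "finite B" using F.finiteI_independent B by blast
  then obtain bs where "distinct bs" "set bs = B" using finite_distinct_list by blast
  moreover have "V.span B = N j" using B(1,3) V.span_minimal subspace_N by blast
  ultimately have "\<exists>bs. distinct bs \<and> V.independent (set bs) \<and> V.span (set bs) = N j"
    using B(2) by blast
  from someI_ex[OF this] show "distinct (pb j)" "V.independent (set (pb j))" "V.span (set (pb j)) = N j"
    unfolding piece_basis_def by blast+
qed

lemma dim_N: "V.dim (N j) = length (pb j)"
  using V.dim_span_eq_card_independent[OF piece_basis(2)[of j]] piece_basis[of j]
  by (simp add: distinct_card)

lemma pb_in_N: "q < length (pb j) \<Longrightarrow> pb j ! q \<in> N j"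
  using piece_basis(3)[of j] V.span_superset nth_mem by blast

text \<open>Outside \<open>N j\<close> the coordinates are zero by the convention for
  \<open>representation\<close>; they carry information only on \<open>N j\<close>.\<close>

definition coord :: "int \<Rightarrow> 'm \<Rightarrow> nat \<Rightarrow> 'k" where
  "coord j x p = V.representation (set (pb j)) x (pb j ! p)"

lemma coord_expand: "x \<in> N j \<Longrightarrow> (\<Sum>p<length (pb j). kscale smul (coord j x p) (pb j ! p)) = x"
proof -
  assume "x \<in> N j"
  then have "(\<Sum>b\<in>set (pb j). kscale smul (V.representation (set (pb j)) x b) b) = x"
    using piece_basis by (intro V.sum_representation_eq) auto
  then show ?thesis
    unfolding coord_def
    using sum.reindex_bij_betw[OF bij_betw_nth[OF piece_basis(1) refl refl],
        of "\<lambda>b. kscale smul (V.representation (set (pb j)) x b) b"] by simp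
qed

lemma coord_sum:
  assumes "\<And>q. q \<in> Q \<Longrightarrow> x q \<in> N j"
  shows "coord j (\<Sum>q\<in>Q. kscale smul (a q) (x q)) p = (\<Sum>q\<in>Q. a q * coord j (x q) p)"
  unfolding coord_def using assms piece_basis[of j] subspace_N V.subspace_scale
  by (simp add: V.representation_sum V.representation_scale)

lemma coord_basis:
  "q < length (pb j) \<Longrightarrow> p < length (pb j) \<Longrightarrow> coord j (pb j ! q) p = (if p = q then 1 else 0)"
  unfolding coord_def using piece_basis[of j]
  by (simp add: V.representation_basis nth_eq_iff_index_eq)

definition mtx :: "('m \<Rightarrow> 'm) \<Rightarrow> int \<Rightarrow> int \<Rightarrow> 'k mat" where
  "mtx \<phi> j k = mat (length (pb k)) (length (pb j)) (\<lambda>(p, q). coord k (\<phi> (pb j ! q)) p)"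

lemma mtx_carrier [simp]: "mtx \<phi> j k \<in> carrier_mat (length (pb k)) (length (pb j))"
  by (simp add: mtx_def)

lemma mtx_dim [simp]: "dim_row (mtx \<phi> j k) = length (pb k)" "dim_col (mtx \<phi> j k) = length (pb j)"
  by (simp_all add: mtx_def)

lemma mtx_cong: "(\<And>x. x \<in> N j \<Longrightarrow> \<phi> x = \<psi> x) \<Longrightarrow> mtx \<phi> j k = mtx \<psi> j k"
  by (rule eq_matI) (auto simp: mtx_def pb_in_N)

lemma mtx_id: "mtx (\<lambda>x. x) j j = 1\<^sub>m (length (pb j))"
  by (rule eq_matI) (auto simp: mtx_def coord_basis)

lemma mtx_comp:
  assumes \<psi>: "Vector_Spaces.linear (kscale smul) (kscale smul) \<psi>"
    and \<phi>_N: "\<And>x. x \<in> N j \<Longrightarrow> \<phi> x \<in> N k" and \<psi>_N: "\<And>x. x \<in> N k \<Longrightarrow> \<psi> x \<in> N m"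
  shows "mtx (\<lambda>x. \<psi> (\<phi> x)) j m = mtx \<psi> k m * mtx \<phi> j k"
proof (rule eq_matI)
  interpret \<psi>: Vector_Spaces.linear "kscale smul" "kscale smul" \<psi> by (rule \<psi>)
  fix p q assume "p < dim_row (mtx \<psi> k m * mtx \<phi> j k)" "q < dim_col (mtx \<psi> k m * mtx \<phi> j k)"
  then have p: "p < length (pb m)" and q: "q < length (pb j)" by auto
  let ?x = "\<phi> (pb j ! q)"
  have "\<psi> ?x = (\<Sum>r<length (pb k). kscale smul (coord k ?x r) (\<psi> (pb k ! r)))"
    by (subst coord_expand[of ?x k, symmetric])
      (simp_all add: \<phi>_N pb_in_N q \<psi>.sum \<psi>.scale)
  also have "coord m \<dots> p = (\<Sum>r<length (pb k). coord k ?x r * coord m (\<psi> (pb k ! r)) p)"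
    by (rule coord_sum) (simp add: \<psi>_N pb_in_N)
  finally have "coord m (\<psi> ?x) p = (\<Sum>r<length (pb k). coord k ?x r * coord m (\<psi> (pb k ! r)) p)" .
  then show "mtx (\<lambda>x. \<psi> (\<phi> x)) j m $$ (p, q) = (mtx \<psi> k m * mtx \<phi> j k) $$ (p, q)"
    using p q by (simp add: mtx_def scalar_prod_def lessThan_atLeast0 mult.commute)
qed (simp_all)

text \<open>The matrix of a section is a right inverse. Stated with matrices, surjectivity over the
  field carries over to the polynomial ring through \<open>cnst\<close>.\<close>

lemma surj_iff_right_inverse:
  assumes "homogeneous 1 l"
  shows "smul l ` N j = N (j + 1) \<longleftrightarrow>
    (\<exists>Z\<in>carrier_mat (length (pb j)) (length (pb (j + 1))).
      mtx (smul l) j (j + 1) * Z = 1\<^sub>m (length (pb (j + 1))))"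
proof
  assume surj: "smul l ` N j = N (j + 1)"
  obtain g where g: "g ` UNIV \<subseteq> N j" "\<forall>v\<in>smul l ` N j. smul l (g v) = v"
    using VP.linear_exists_right_inverse_on[OF linear_smul subspace_N] by metis
  have "mtx (\<lambda>x. smul l (g x)) (j + 1) (j + 1) = mtx (smul l) j (j + 1) * mtx g (j + 1) j"
    by (rule mtx_comp[OF linear_smul]) (use g(1) smul_linear_form_N[OF assms] in auto)
  moreover have "mtx (\<lambda>x. smul l (g x)) (j + 1) (j + 1) = 1\<^sub>m (length (pb (j + 1)))"
    unfolding mtx_id[symmetric] by (rule mtx_cong) (use g(2) surj in auto)
  ultimately show "\<exists>Z\<in>carrier_mat (length (pb j)) (length (pb (j + 1))).
      mtx (smul l) j (j + 1) * Z = 1\<^sub>m (length (pb (j + 1)))"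
    by (intro bexI[of _ "mtx g (j + 1) j"]) simp_all
next
  assume "\<exists>Z\<in>carrier_mat (length (pb j)) (length (pb (j + 1))).
      mtx (smul l) j (j + 1) * Z = 1\<^sub>m (length (pb (j + 1)))"
  then obtain Z where Z: "Z \<in> carrier_mat (length (pb j)) (length (pb (j + 1)))"
    "mtx (smul l) j (j + 1) * Z = 1\<^sub>m (length (pb (j + 1)))" by blast
  have "pb (j + 1) ! p \<in> smul l ` N j" if p: "p < length (pb (j + 1))" for p
  proof -
    \<comment> \<open>Column \<open>p\<close> of \<open>Z\<close> read as coordinates; this is the
      preimage of the \<open>p\<close>-th basis vector.\<close>
    let ?z = "\<Sum>q<length (pb j). kscale smul (Z $$ (q, p)) (pb j ! q)"
    have z: "?z \<in> N j"
      by (intro V.subspace_sum[OF subspace_N] V.subspace_scale[OF subspace_N] pb_in_N) simp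
    interpret l: Vector_Spaces.linear "kscale smul" "kscale smul" "smul l" by (rule linear_smul)
    have lz: "smul l ?z = (\<Sum>q<length (pb j). kscale smul (Z $$ (q, p)) (smul l (pb j ! q)))"
      by (simp add: l.sum l.scale)
    have "coord (j + 1) (smul l ?z) r = (if r = p then 1 else 0)" if r: "r < length (pb (j + 1))" for r
    proof -
      have "coord (j + 1) (smul l ?z) r = (\<Sum>q<length (pb j). Z $$ (q, p) * coord (j + 1) (smul l (pb j ! q)) r)"
        unfolding lz by (rule coord_sum) (use smul_linear_form_N[OF assms] pb_in_N in auto)
      also have "\<dots> = (mtx (smul l) j (j + 1) * Z) $$ (r, p)"
        using Z(1) p r by (simp add: mtx_def scalar_prod_def lessThan_atLeast0 mult.commute)
      finally show ?thesis using Z(2) p r by simp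
    qed
    then have "(\<Sum>r<length (pb (j + 1)). kscale smul (coord (j + 1) (smul l ?z) r) (pb (j + 1) ! r)) =
        (\<Sum>r<length (pb (j + 1)). if r = p then pb (j + 1) ! r else 0)"
      by (intro sum.cong) auto
    then have "smul l ?z = pb (j + 1) ! p"
      using coord_expand[OF smul_linear_form_N[OF assms z]] p by simp
    from image_eqI[of _ "smul l", OF this[symmetric] z] show ?thesis .
  qed
  then have "set (pb (j + 1)) \<subseteq> smul l ` N j" by (auto simp: in_set_conv_nth)
  then have "N (j + 1) \<subseteq> smul l ` N j"
    using V.span_minimal VP.linear_subspace_image[OF linear_smul subspace_N] piece_basis(3) by metis
  then show "smul l ` N j = N (j + 1)" using smul_linear_form_N[OF assms] by blast
qed

text \<open>The matrix of a linear left inverse serves as \<open>Z\<close>. Conversely,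
  \<open>Z\<close> applied to the zero image of a kernel vector returns its coordinate vector, which
  is therefore zero.\<close>

lemma inj_iff_left_inverse:
  assumes "homogeneous 1 l"
  shows "inj_on (smul l) (N j) \<longleftrightarrow>
    (\<exists>Z\<in>carrier_mat (length (pb j)) (length (pb (j + 1))).
      Z * mtx (smul l) j (j + 1) = 1\<^sub>m (length (pb j)))"
proof
  assume inj: "inj_on (smul l) (N j)"
  obtain g where g: "g ` UNIV \<subseteq> N j" "\<forall>v\<in>N j. g (smul l v) = v"
    "Vector_Spaces.linear (kscale smul) (kscale smul) g"
    using VP.linear_exists_left_inverse_on[OF linear_smul subspace_N inj] by metis
  have "mtx (\<lambda>x. g (smul l x)) j j = mtx g (j + 1) j * mtx (smul l) j (j + 1)"
    by (rule mtx_comp[OF g(3)]) (use g(1) smul_linear_form_N[OF assms] in auto)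
  moreover have "mtx (\<lambda>x. g (smul l x)) j j = 1\<^sub>m (length (pb j))"
    unfolding mtx_id[symmetric] by (rule mtx_cong) (use g(2) in auto)
  ultimately show "\<exists>Z\<in>carrier_mat (length (pb j)) (length (pb (j + 1))).
      Z * mtx (smul l) j (j + 1) = 1\<^sub>m (length (pb j))"
    by (intro bexI[of _ "mtx g (j + 1) j"]) simp_all
next
  assume "\<exists>Z\<in>carrier_mat (length (pb j)) (length (pb (j + 1))).
      Z * mtx (smul l) j (j + 1) = 1\<^sub>m (length (pb j))"
  then obtain Z where Z: "Z \<in> carrier_mat (length (pb j)) (length (pb (j + 1)))"
    "Z * mtx (smul l) j (j + 1) = 1\<^sub>m (length (pb j))" by blast
  have "x = 0" if x: "x \<in> N j" "smul l x = 0" for x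
  proof -
    let ?v = "vec (length (pb j)) (coord j x)"
    interpret l: Vector_Spaces.linear "kscale smul" "kscale smul" "smul l" by (rule linear_smul)
    have "0 = coord (j + 1) (smul l (\<Sum>q<length (pb j). kscale smul (coord j x q) (pb j ! q))) p" for p
      unfolding coord_expand[OF x(1)] x(2) by (simp add: coord_def V.representation_zero)
    also have "\<dots> p = (\<Sum>q<length (pb j). coord j x q * coord (j + 1) (smul l (pb j ! q)) p)" for p
      unfolding l.sum l.scale by (rule coord_sum) (use smul_linear_form_N[OF assms] pb_in_N in auto)
    finally have "mtx (smul l) j (j + 1) *\<^sub>v ?v = 0\<^sub>v (length (pb (j + 1)))"
      by (intro eq_vecI) (auto simp: mtx_def scalar_prod_def lessThan_atLeast0 mult.commute)
    then have "?v = Z *\<^sub>v 0\<^sub>v (length (pb (j + 1)))"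
      using assoc_mult_mat_vec[OF Z(1) mtx_carrier[of "smul l" j "j + 1"], of ?v] Z(2) by simp
    then have "?v = 0\<^sub>v (length (pb j))" using Z(1) by auto
    then have "coord j x q = 0" if "q < length (pb j)" for q
      using that by (metis index_vec index_zero_vec(1))
    then show ?thesis using coord_expand[OF x(1)] by simp
  qed
  then show "inj_on (smul l) (N j)"
    using VP.linear_inj_on_iff_eq_0[OF linear_smul subspace_N] by blast
qed

section \<open>The matrix of linear forms and its ideals of minors\<close>

abbreviation X :: "int \<Rightarrow> ('n, 'k) mpoly mat" where
  "X \<equiv> mult_matrix smul N"

lemma X_carrier [simp]: "X j \<in> carrier_mat (length (pb (j + 1))) (length (pb j))"
  by (simp add: mult_matrix_def Let_def)

lemma X_dim [simp]: "dim_row (X j) = length (pb (j + 1))" "dim_col (X j) = length (pb j)"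
  using X_carrier[of j] by blast+

lemma X_index:
  assumes "p < length (pb (j + 1))" "q < length (pb j)"
  shows "X j $$ (p, q) = (\<Sum>i\<in>UNIV. cnst (mtx (smul (var i)) j (j + 1) $$ (p, q)) * var i)"
  using assms by (simp add: mult_matrix_def Let_def mtx_def coord_def)

text \<open>Coordinates are linear, and the entries of \<open>X j\<close> record the contribution of
  each variable. Specialising the matrix at a point thus gives an actual multiplication map, which
  ties minors to forms of maximal rank.\<close>

lemma mtx_linear_form:
  "mtx (smul (\<Sum>i\<in>UNIV. cnst (a i) * var i)) j (j + 1) = map_mat (eval_at a) (X j)"
proof (rule eq_matI)
  fix p q assume "p < dim_row (map_mat (eval_at a) (X j))" "q < dim_col (map_mat (eval_at a) (X j))"
  then have pq: "p < length (pb (j + 1))" "q < length (pb j)" by auto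
  have "smul (\<Sum>i\<in>UNIV. cnst (a i) * var i) (pb j ! q) =
      (\<Sum>i\<in>UNIV. kscale smul (a i) (smul (var i) (pb j ! q)))"
    by (simp add: scale_sum_left kscale_def)
  then have "coord (j + 1) (smul (\<Sum>i\<in>UNIV. cnst (a i) * var i) (pb j ! q)) p =
      (\<Sum>i\<in>UNIV. a i * coord (j + 1) (smul (var i) (pb j ! q)) p)"
    using coord_sum[of UNIV "\<lambda>i. smul (var i) (pb j ! q)"] var_N pb_in_N[OF pq(2)] by simp
  then show "mtx (smul (\<Sum>i\<in>UNIV. cnst (a i) * var i)) j (j + 1) $$ (p, q) = map_mat (eval_at a) (X j) $$ (p, q)"
    using pq by (simp add: X_index eval_at_sum eval_at_mult) (simp add: mtx_def mult.commute)
qed simp_all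

text \<open>Multiplications by \<open>l\<close> and by each variable commute, and the two products
  are compared variable by variable. This is the commuting square behind the map of cokernels
  induced by \<open>l\<close>.\<close>

lemma X_commute:
  assumes "homogeneous 1 l"
  shows "map_mat cnst (mtx (smul l) (j + 1) (j + 2)) * X j =
    X (j + 1) * map_mat cnst (mtx (smul l) j (j + 1))"
proof (rule eq_matI)
  have j2: "j + 1 + 1 = j + 2" by simp
  let ?L = "\<lambda>j. mtx (smul l) j (j + 1)" and ?M = "\<lambda>i j. mtx (smul (var i)) j (j + 1)"
  have comm: "?L (j + 1) * ?M i j = ?M i (j + 1) * ?L j" for i
  proof -
    have "?L (j + 1) * ?M i j = mtx (\<lambda>x. smul l (smul (var i) x)) j (j + 1 + 1)"
      by (rule mtx_comp[symmetric, OF linear_smul]) (erule var_N smul_linear_form_N[OF assms])+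
    moreover have "?M i (j + 1) * ?L j = mtx (\<lambda>x. smul (var i) (smul l x)) j (j + 1 + 1)"
      by (rule mtx_comp[symmetric, OF linear_smul]) (erule var_N smul_linear_form_N[OF assms])+
    ultimately show ?thesis by (simp add: mult.commute)
  qed
  fix p q assume "p < dim_row (X (j + 1) * map_mat cnst (?L j))" "q < dim_col (X (j + 1) * map_mat cnst (?L j))"
  then have p: "p < length (pb (j + 1 + 1))" and q: "q < length (pb j)" by auto
  let ?n = "length (pb (j + 1))"
  have "(map_mat cnst (?L (j + 1)) * X j) $$ (p, q) =
      (\<Sum>r<?n. cnst (?L (j + 1) $$ (p, r)) * (\<Sum>i\<in>UNIV. cnst (?M i j $$ (r, q)) * var i))"
    using p q by (simp add: scalar_prod_def lessThan_atLeast0 X_index)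
  also have "\<dots> = (\<Sum>i\<in>UNIV. cnst (\<Sum>r<?n. ?L (j + 1) $$ (p, r) * ?M i j $$ (r, q)) * var i)"
    by (subst sum_distrib_left, subst sum.swap)
      (simp add: cnst_sum cnst_mult sum_distrib_right mult.assoc)
  also have "\<dots> = (\<Sum>i\<in>UNIV. cnst ((?L (j + 1) * ?M i j) $$ (p, q)) * var i)"
    using p q by (simp add: scalar_prod_def lessThan_atLeast0)
  also have "\<dots> = (\<Sum>i\<in>UNIV. cnst ((?M i (j + 1) * ?L j) $$ (p, q)) * var i)"
    unfolding comm ..
  also have "\<dots> = (\<Sum>i\<in>UNIV. cnst (\<Sum>r<?n. ?M i (j + 1) $$ (p, r) * ?L j $$ (r, q)) * var i)"
    using p q by (simp add: scalar_prod_def lessThan_atLeast0)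
  also have "\<dots> = (\<Sum>r<?n. (\<Sum>i\<in>UNIV. cnst (?M i (j + 1) $$ (p, r)) * var i) * cnst (?L j $$ (r, q)))"
    by (subst sum_distrib_right, subst sum.swap)
      (simp add: cnst_sum cnst_mult sum_distrib_left sum_distrib_right mult_ac)
  also have "\<dots> = (X (j + 1) * map_mat cnst (?L j)) $$ (p, q)"
    using p q by (simp add: scalar_prod_def lessThan_atLeast0 X_index)
  finally show "(map_mat cnst (mtx (smul l) (j + 1) (j + 2)) * X j) $$ (p, q) =
      (X (j + 1) * map_mat cnst (?L j)) $$ (p, q)" unfolding j2 .
qed (simp_all add: add.commute)

text \<open>Multiplication by \<open>l\<close> from \<open>N (j + 1)\<close> to
  \<open>N (j + 2)\<close> induces the surjection of cokernels; its right inverse over the field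
  remains one after \<open>cnst\<close>. The dimension bounds make both matrices wide.\<close>

lemma ideal_mono_of_surj:
  assumes l: "homogeneous 1 l" and surj: "smul l ` N (j + 1) = N (j + 2)"
    and dims: "V.dim (N (j + 1)) \<le> V.dim (N j)" "V.dim (N (j + 2)) \<le> V.dim (N (j + 1))"
  shows "non_lefschetz_ideal_at smul N j \<subseteq> non_lefschetz_ideal_at smul N (j + 1)"
proof -
  have j2: "j + 1 + 1 = j + 2" by simp
  obtain Z where Z: "Z \<in> carrier_mat (length (pb (j + 1))) (length (pb (j + 2)))"
    "mtx (smul l) (j + 1) (j + 2) * Z = 1\<^sub>m (length (pb (j + 2)))"
    using surj_iff_right_inverse[OF l, of "j + 1"] surj unfolding j2 by blast
  interpret c: semiring_hom "cnst :: 'k \<Rightarrow> ('n, 'k) mpoly"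
    by unfold_locales (simp_all add: cnst_add cnst_mult)
  have "map_mat cnst (mtx (smul l) (j + 1) (j + 2)) * map_mat cnst Z = (1\<^sub>m (length (pb (j + 2))) :: ('n, 'k) mpoly mat)"
    using c.mat_hom_mult[OF mtx_carrier Z(1), symmetric] Z(2) by (simp add: c.mat_hom_one)
  then show ?thesis
    unfolding non_lefschetz_ideal_at_def
    using X_commute[OF l] X_carrier[of j] X_carrier[of "j + 1"] dims
    by (intro ideal_span_maximal_minors_mono
          [of _ "length (pb (j + 1))" "length (pb j)" _ "length (pb (j + 2))"])
       (use Z in \<open>auto simp: dim_N j2\<close>)
qed

text \<open>Transposing makes both matrices wide and the left inverse of \<open>l\<close> on
  \<open>N j\<close> a right inverse. It also reverses the direction of the square, hence of the
  inclusion.\<close>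

lemma ideal_mono_of_inj:
  assumes l: "homogeneous 1 l" and inj: "inj_on (smul l) (N j)"
    and dims: "V.dim (N j) \<le> V.dim (N (j + 1))" "V.dim (N (j + 1)) \<le> V.dim (N (j + 2))"
  shows "non_lefschetz_ideal_at smul N (j + 1) \<subseteq> non_lefschetz_ideal_at smul N j"
proof -
  have j2: "j + 1 + 1 = j + 2" by simp
  let ?L = "map_mat cnst (mtx (smul l) j (j + 1)) :: ('n, 'k) mpoly mat"
    and ?L' = "map_mat cnst (mtx (smul l) (j + 1) (j + 2)) :: ('n, 'k) mpoly mat"
  obtain Z where Z: "Z \<in> carrier_mat (length (pb j)) (length (pb (j + 1)))"
    "Z * mtx (smul l) j (j + 1) = 1\<^sub>m (length (pb j))"
    using inj_iff_left_inverse[OF l] inj by blast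
  interpret c: semiring_hom "cnst :: 'k \<Rightarrow> ('n, 'k) mpoly"
    by unfold_locales (simp_all add: cnst_add cnst_mult)
  have X1: "X (j + 1) \<in> carrier_mat (length (pb (j + 2))) (length (pb (j + 1)))"
    using X_carrier[of "j + 1"] unfolding j2 .
  have L: "?L \<in> carrier_mat (length (pb (j + 1))) (length (pb j))"
    and L': "?L' \<in> carrier_mat (length (pb (j + 2))) (length (pb (j + 1)))" by simp_all
  have "map_mat cnst Z * ?L = 1\<^sub>m (length (pb j))"
    using c.mat_hom_mult[OF Z(1) mtx_carrier, symmetric] Z(2) by (simp add: c.mat_hom_one)
  then have inv: "?L\<^sup>T * (map_mat cnst Z)\<^sup>T = 1\<^sub>m (length (pb j))"
    using transpose_mult[of "map_mat cnst Z" "length (pb j)" "length (pb (j + 1))" ?L "length (pb j)"] Z(1) L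
    by simp
  have comm: "?L\<^sup>T * (X (j + 1))\<^sup>T = (X j)\<^sup>T * ?L'\<^sup>T"
    using X_commute[OF l, of j] transpose_mult[OF L' X_carrier] transpose_mult[OF X1 L] by simp
  have "ideal_span (maximal_minors (X (j + 1))\<^sup>T) \<subseteq> ideal_span (maximal_minors (X j)\<^sup>T)"
    using comm inv X1 X_carrier[of j] L L' Z(1) dims
    by (intro ideal_span_maximal_minors_mono
          [of _ "length (pb (j + 1))" "length (pb (j + 2))" _ "length (pb j)"])
       (auto simp: dim_N)
  then show ?thesis by (simp add: non_lefschetz_ideal_at_def maximal_minors_transpose)
qed

text \<open>At a point where the minor does not vanish, the form with these coordinates as
  coefficients has an invertible maximal submatrix, hence a one-sided inverse.\<close>

lemma max_rank_of_minor:
  assumes D: "D \<in> maximal_minors (X j)" "D \<noteq> 0"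
  shows "\<exists>l. homogeneous 1 l \<and> max_rank_at smul N j l"
proof -
  obtain a where a: "eval_at a D \<noteq> 0" using mpoly_eq_zero_if_eval_at_zero D(2) by blast
  interpret e: comm_ring_hom "eval_at a :: ('n, 'k) mpoly \<Rightarrow> 'k" by (rule comm_ring_hom_eval_at)
  define l :: "('n, 'k) mpoly" where "l = (\<Sum>i\<in>UNIV. cnst (a i) * var i)"
  have l: "homogeneous 1 l" unfolding l_def by (rule homogeneous_linear_form)
  let ?M = "mtx (smul l) j (j + 1)"
  have M: "?M = map_mat (eval_at a) (X j)" unfolding l_def by (rule mtx_linear_form)
  have ev: "map_mat (eval_at a) (mat n n (\<lambda>(i, k). A $$ (i, f k))) = mat n n (\<lambda>(i, k). map_mat (eval_at a) A $$ (i, f k))"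
    if "A \<in> carrier_mat n m" "\<And>k. k < n \<Longrightarrow> f k < m" for A :: "('n, 'k) mpoly mat" and n m f
    by (rule eq_matI) (use that in auto)
  \<comment> \<open>Stated for any wide matrix because it is applied to \<open>X j\<close> in the
    surjective case and to its transpose in the injective one.\<close>
  have wide: "\<exists>Z\<in>carrier_mat m n. map_mat (eval_at a) A * Z = 1\<^sub>m n"
    if A: "A \<in> carrier_mat n m" "n \<le> m" "D \<in> maximal_minors A" for A :: "('n, 'k) mpoly mat" and n m
  proof -
    obtain J where J: "J \<subseteq> {..<m}" "card J = n" "D = det (mat n n (\<lambda>(i, k). A $$ (i, pick J k)))"
      using A(3) unfolding maximal_minors_wide[OF A(1,2)] by blast
    have pick: "pick J k < m" if "k < n" for k
      using pick_in_set[of k J] that J by auto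
    have evJ: "map_mat (eval_at a) (mat n n (\<lambda>(i, k). A $$ (i, pick J k))) =
        mat n n (\<lambda>(i, k). map_mat (eval_at a) A $$ (i, pick J k))"
      by (rule ev[OF A(1)]) (rule pick)
    have "det (mat n n (\<lambda>(i, k). map_mat (eval_at a) A $$ (i, pick J k))) \<noteq> 0"
      using a unfolding J(3) evJ[symmetric] e.hom_det .
    then show ?thesis
      using right_inverse_of_minor[of "map_mat (eval_at a) A" n m "pick J"] A(1) pick by fastforce
  qed
  show ?thesis
  proof (cases "length (pb (j + 1)) \<le> length (pb j)")
    case True
    then have "smul l ` N j = N (j + 1)"
      using wide[OF X_carrier _ D(1)] surj_iff_right_inverse[OF l] M by simp
    then show ?thesis using l True max_rank_at_iff_surj[OF l, of j] by (auto simp: dim_N)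
  next
    case False
    have XT: "(X j)\<^sup>T \<in> carrier_mat (length (pb j)) (length (pb (j + 1)))" by simp
    obtain Z where Z: "Z \<in> carrier_mat (length (pb (j + 1))) (length (pb j))"
      "map_mat (eval_at a) (X j)\<^sup>T * Z = 1\<^sub>m (length (pb j))"
      using wide[OF XT] False D(1) by (auto simp: maximal_minors_transpose)
    have "(map_mat (eval_at a) (X j)\<^sup>T * Z)\<^sup>T = Z\<^sup>T * ?M"
      unfolding M using transpose_mult[of "map_mat (eval_at a) (X j)\<^sup>T" "length (pb j)" "length (pb (j + 1))" Z "length (pb j)"] Z(1)
      by (simp flip: map_mat_transpose)
    then have "Z\<^sup>T * ?M = 1\<^sub>m (length (pb j))" using Z(2) by simp
    then have "inj_on (smul l) (N j)"
      using inj_iff_left_inverse[OF l, of j] Z(1) by (metis transpose_carrier_mat)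
    then show ?thesis using l False max_rank_at_iff_inj[OF l, of j] by (auto simp: dim_N)
  qed
qed

lemma zero_in_ideal_at: "0 \<in> non_lefschetz_ideal_at smul N j"
proof -
  interpret A: Modules.module "(*) :: ('n, 'k) mpoly \<Rightarrow> _ \<Rightarrow> _"
    by (rule module_mult)
  show ?thesis by (simp add: non_lefschetz_ideal_at_def ideal_span_def A.span_zero)
qed

lemma ideal_at_eq_zero:
  assumes "\<And>l. homogeneous 1 l \<Longrightarrow> \<not> max_rank_at smul N j l"
  shows "non_lefschetz_ideal_at smul N j = {0}"
proof -
  interpret A: Modules.module "(*) :: ('n, 'k) mpoly \<Rightarrow> _ \<Rightarrow> _"
    by (rule module_mult)
  have "maximal_minors (X j) \<subseteq> {0}" using max_rank_of_minor assms by blast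
  then have "ideal_span (maximal_minors (X j)) \<subseteq> {0}"
    unfolding ideal_span_def by (rule A.span_minimal) (simp add: A.subspace_def)
  then show ?thesis using zero_in_ideal_at[of j] by (auto simp: non_lefschetz_ideal_at_def)
qed

section \<open>The two critical degrees\<close>

text \<open>The inclusions of the two loci in the whole locus, and of the full intersection of
  ideals in that of two of them, are immediate; the assumptions supply the converses.\<close>

lemma union_of_two_loci:
  assumes pts: "\<And>l j. homogeneous 1 l \<Longrightarrow> max_rank_at smul N (t - 1) l \<Longrightarrow> max_rank_at smul N t l \<Longrightarrow>
      max_rank_at smul N j l"
    and ideals: "\<And>j. non_lefschetz_ideal_at smul N (t - 1) \<inter> non_lefschetz_ideal_at smul N t
      \<subseteq> non_lefschetz_ideal_at smul N j"
  shows "non_lefschetz_locus smul N =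
      non_lefschetz_locus_at smul N (t - 1) \<union> non_lefschetz_locus_at smul N t \<and>
    non_lefschetz_ideal smul N =
      non_lefschetz_ideal_at smul N (t - 1) \<inter> non_lefschetz_ideal_at smul N t"
proof
  have "lefschetz_element smul N l \<longleftrightarrow> max_rank_at smul N (t - 1) l \<and> max_rank_at smul N t l"
    if "homogeneous 1 l" for l
    using that pts by (auto simp: lefschetz_element_def)
  then show "non_lefschetz_locus smul N =
      non_lefschetz_locus_at smul N (t - 1) \<union> non_lefschetz_locus_at smul N t"
    unfolding non_lefschetz_locus_def non_lefschetz_locus_at_def by blast
  show "non_lefschetz_ideal smul N =
      non_lefschetz_ideal_at smul N (t - 1) \<inter> non_lefschetz_ideal_at smul N t"
    using ideals by (auto simp: non_lefschetz_ideal_def)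
qed

lemma dim_zero: "N j = {0} \<Longrightarrow> V.dim (N j) = 0"
  using V.dim_le_card[of "N j" "{}"] by simp

lemma locus_two_degrees:
  "\<exists>j. non_lefschetz_locus smul N =
      non_lefschetz_locus_at smul N (j - 1) \<union> non_lefschetz_locus_at smul N j \<and>
    non_lefschetz_ideal smul N =
      non_lefschetz_ideal_at smul N (j - 1) \<inter> non_lefschetz_ideal_at smul N j"
proof (cases "\<exists>j. \<forall>l. homogeneous 1 l \<longrightarrow> \<not> max_rank_at smul N j l")
  case True
  then obtain t where t: "\<And>l. homogeneous 1 l \<Longrightarrow> \<not> max_rank_at smul N t l" by blast
  then have "non_lefschetz_ideal_at smul N t = {0}" by (rule ideal_at_eq_zero)
  then show ?thesis
    \<comment> \<open>No form has maximal rank in degree \<open>t\<close>, so the condition on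
      points is vacuous, and the zero ideal lies in every other ideal.\<close>
    using t zero_in_ideal_at by (intro exI[of _ t] union_of_two_loci) auto
next
  case False
  \<comment> \<open>The form may vary with the degree; no single form has to have maximal rank in
    all degrees.\<close>
  then obtain y where y: "\<And>j. homogeneous 1 (y j)" "\<And>j. max_rank_at smul N j (y j)" by metis
  let ?h = "\<lambda>j. V.dim (N j)"
  have j2: "j + 1 + 1 = j + 2" for j :: int by simp
  \<comment> \<open>Degree \<open>c\<close> is a witness that the Hilbert function fails to rise, so
    the least such degree exists and is at most \<open>c\<close>.\<close>
  have hc: "?h (c + 1) \<le> ?h c" using dim_zero[OF N_above_c[of "c + 1"]] by simp
  define n where "n = (LEAST n. ?h (int n + 1) \<le> ?h (int n))"
  define t where "t = int n"
  have ex: "?h (int (nat c) + 1) \<le> ?h (int (nat c))" using hc c_nonneg by simp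
  have t_drop: "?h (t + 1) \<le> ?h t" unfolding t_def n_def by (rule LeastI[of "\<lambda>n. ?h (int n + 1) \<le> ?h (int n)", OF ex])
  have t0: "t \<ge> 0" by (simp add: t_def)
  have "n \<le> nat c" unfolding n_def by (rule Least_le[of "\<lambda>n. ?h (int n + 1) \<le> ?h (int n)", OF ex])
  then have tc: "t \<le> c" using c_nonneg by (simp add: t_def)
  have below: "?h j \<le> ?h (j + 1)" if "j < t" for j
  proof (cases "j \<ge> 0")
    case True
    then have "\<not> ?h (int (nat j) + 1) \<le> ?h (int (nat j))"
      using that unfolding t_def n_def by (intro not_less_Least) simp
    then show ?thesis using True by simp
  next
    case False
    then show ?thesis using dim_zero[OF N_neg[of j]] by simp
  qed
  \<comment> \<open>The form \<open>y j\<close>, surjective in degree \<open>j\<close>, is also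
    surjective in degree \<open>j + 1\<close>; this yields the next inequality of
    dimensions.\<close>
  have above: "?h (j + 1) \<le> ?h j" if "t \<le> j" for j
    using that
  proof (induction j rule: int_ge_induct)
    case base
    show ?case by (rule t_drop)
  next
    case (step j)
    then have "smul (y j) ` N j = N (j + 1)" using max_rank_at_iff_surj[OF y(1)] y(2) by blast
    then have "smul (y j) ` N (j + 1) = N (j + 1 + 1)" using surj_step[OF y(1), of j] step t0 by (simp add: add.commute)
    then show ?case by (rule dim_le_of_surj)
  qed
  have max_up: "max_rank_at smul N (j + 1) l"
    if "homogeneous 1 l" "t \<le> j" "max_rank_at smul N j l" for j l
  proof -
    have "smul l ` N j = N (j + 1)" using max_rank_at_iff_surj that above by blast
    then have "smul l ` N (j + 1) = N (j + 1 + 1)" using surj_step[of l j] that t0 by (simp add: add.commute)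
    then show ?thesis using max_rank_at_iff_surj[of l "j + 1"] that above[of "j + 1"] by simp
  qed
  have ideal_up: "non_lefschetz_ideal_at smul N j \<subseteq> non_lefschetz_ideal_at smul N (j + 1)"
    if "t \<le> j" for j
  proof -
    have "smul (y j) ` N j = N (j + 1)" using max_rank_at_iff_surj y that above by blast
    then have "smul (y j) ` N (j + 1) = N (j + 2)" using surj_step[of "y j" j] that t0 y by simp
    moreover have "?h (j + 2) \<le> ?h (j + 1)" using above[of "j + 1"] that unfolding j2 by simp
    ultimately show ?thesis using ideal_mono_of_surj[OF y(1)] above[OF that] by blast
  qed
  \<comment> \<open>From \<open>j + 1 < t\<close> and \<open>t \<le> c\<close> one gets
    \<open>j < c\<close>, as the descent of injectivity requires.\<close>
  have max_down: "max_rank_at smul N j l"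
    if "homogeneous 1 l" "j + 1 < t" "max_rank_at smul N (j + 1) l" for j l
    using max_rank_at_iff_inj[of l "j + 1"] max_rank_at_iff_inj[of l j] below[of "j + 1"] below[of j]
      inj_step[of l j] that tc by simp
  have ideal_down: "non_lefschetz_ideal_at smul N (j + 1) \<subseteq> non_lefschetz_ideal_at smul N j"
    if "j + 1 < t" for j
  proof -
    \<comment> \<open>The form is taken from degree \<open>j + 1\<close>, since injectivity descends
      from there to \<open>N j\<close>.\<close>
    have "inj_on (smul (y (j + 1))) (N (j + 1))"
      using max_rank_at_iff_inj[of "y (j + 1)" "j + 1"] below[of "j + 1"] y that by simp
    then have "inj_on (smul (y (j + 1))) (N j)" using inj_step y(1) that tc by simp
    moreover have "?h (j + 1) \<le> ?h (j + 2)" using below[of "j + 1"] that unfolding j2 by simp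
    moreover have "?h j \<le> ?h (j + 1)" using below[of j] that by simp
    ultimately show ?thesis using ideal_mono_of_inj[OF y(1)] by blast
  qed
  show ?thesis
  proof (intro exI[of _ t] union_of_two_loci)
    fix l :: "('n, 'k) mpoly" and j
    assume l: "homogeneous 1 l" "max_rank_at smul N (t - 1) l" "max_rank_at smul N t l"
    show "max_rank_at smul N j l"
    proof (cases "t \<le> j")
      case True
      then show ?thesis by (induction j rule: int_ge_induct) (use l max_up in auto)
    next
      case False
      then have "j \<le> t - 1" by simp
      then show ?thesis
      proof (induction j rule: int_le_induct)
        case (step j)
        then show ?case using max_down[OF l(1), of "j - 1"] by simp
      qed (use l in simp)
    qed
  next
    fix j
    show "non_lefschetz_ideal_at smul N (t - 1) \<inter> non_lefschetz_ideal_at smul N t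
      \<subseteq> non_lefschetz_ideal_at smul N j"
    proof (cases "t \<le> j")
      case True
      then have "non_lefschetz_ideal_at smul N t \<subseteq> non_lefschetz_ideal_at smul N j"
        by (induction j rule: int_ge_induct) (use ideal_up in auto)
      then show ?thesis by blast
    next
      case False
      then have "j \<le> t - 1" by simp
      then have "non_lefschetz_ideal_at smul N (t - 1) \<subseteq> non_lefschetz_ideal_at smul N j"
      proof (induction j rule: int_le_induct)
        case (step j)
        then show ?case using ideal_down[of "j - 1"] by auto
      qed simp
      then show ?thesis by blast
    qed
  qed
qed

end

theorem corollary5p8:
  fixes smul :: "('n::finite, 'k::{alg_closed_field, field_char_0}) mpoly \<Rightarrow> 'm::ab_group_add \<Rightarrow> 'm"
    and N :: "int \<Rightarrow> 'm set"
    and c :: int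
  assumes "graded_module smul N"
    and "finitely_generated_module smul"
    and "artinian_module smul"
    and "nonneg_graded N"
    and "level smul N"
    and "max_socle_degree smul N c"
  shows "\<exists>j. non_lefschetz_locus smul N =
               non_lefschetz_locus_at smul N (j - 1) \<union> non_lefschetz_locus_at smul N j \<and>
             non_lefschetz_ideal smul N =
               non_lefschetz_ideal_at smul N (j - 1) \<inter> non_lefschetz_ideal_at smul N j"
proof -
  interpret G: graded_module smul N by fact
  obtain c' where c': "socle smul = N c'" using assms(5) by (auto simp: level_def)
  have ne: "socle smul \<inter> N c \<noteq> {0}" using assms(6) by (simp add: max_socle_degree_def)
  \<comment> \<open>A nonzero socle element of degree \<open>c\<close> also lies in
    \<open>N c'\<close>, and distinct degrees meet only in zero.\<close>
  have "c' = c"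
    using ne G.N_disjoint[of _ c' c] G.zero_in_N unfolding c' by blast
  then have "level_module smul N c"
    using assms ne c' by unfold_locales (auto simp: level_def)
  then show ?thesis by (rule level_module.locus_two_degrees)
qed

end
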